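(* Let $g_1,\dots,g_N\in L^2(\mathbb{R})$ and $\Lambda_1,\dots,\Lambda_N\subset\mathbb{R}^2$. If $\bigcup_{n=1}^N G(g_n,\Lambda_n)$ is uniformly minimal in $L^2(\mathbb{R})$, then \[ D^+(\{\Lambda_n\}):=\limsup_{R\to\infty}\frac{\sup_{(a,b)\in\mathbb{R}^2}\sum_{n=1}^N|\Lambda_n\cap Q_{(a,b)}(R)|}{(2R)^2}\le 1. \]
   Context: For $g\in L^2(\mathbb{R})$ and $(a,b)\in\mathbb{R}^2$ put $g_{ab}(t)=e^{2\pi i b t}g(t-a)$. The Gabor system is $G(g,\Lambda)=\{g_{\lambda\mu}\}_{(\lambda,\mu)\in\Lambda}$. $Q_{(a,b)}(R)=\{(x,y):|x-a|\le R,\ |y-b|\le R\}$. A system is uniformly minimal if there is $\delta>0$ such that each element has distance greater than $\delta$ from the closed span of the remaining elements. *)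

theory Defs
  imports "HOL-Analysis.Analysis"
begin

definition in_L2 :: "(real \<Rightarrow> complex) \<Rightarrow> bool" where
  "in_L2 f \<longleftrightarrow> f \<in> borel_measurable lborel \<and> integrable lborel (\<lambda>t. (cmod (f t))\<^sup>2)"

definition L2_norm :: "(real \<Rightarrow> complex) \<Rightarrow> real" where
  "L2_norm f = sqrt (LINT t|lborel. (cmod (f t))\<^sup>2)"

definition tf_shift :: "(real \<Rightarrow> complex) \<Rightarrow> real \<Rightarrow> real \<Rightarrow> real \<Rightarrow> complex" where
  "tf_shift g a b = (\<lambda>t. cis (2 * pi * b * t) * g (t - a))"

text \<open>L^2 distance from f to the closed linear span of the family e restricted to the
  index set S (= infimum of distances to finite linear combinations).\<close>
definition L2_dist_span :: "('i \<Rightarrow> real \<Rightarrow> complex) \<Rightarrow> 'i set \<Rightarrow> (real \<Rightarrow> complex) \<Rightarrow> real" where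
  "L2_dist_span e S f = Inf {L2_norm (\<lambda>t. f t - (\<Sum>i\<in>F. c i * e i t)) | F c. finite F \<and> F \<subseteq> S}"

definition uniformly_minimal :: "('i \<Rightarrow> real \<Rightarrow> complex) \<Rightarrow> 'i set \<Rightarrow> bool" where
  "uniformly_minimal e I \<longleftrightarrow> (\<exists>\<delta>>0. \<forall>i\<in>I. L2_dist_span e (I - {i}) (e i) > \<delta>)"

definition Qsq :: "real \<Rightarrow> real \<Rightarrow> real \<Rightarrow> (real \<times> real) set" where
  "Qsq a b R = {(x, y). \<bar>x - a\<bar> \<le> R \<and> \<bar>y - b\<bar> \<le> R}"

definition ecard :: "'a set \<Rightarrow> ereal" where
  "ecard S = (if finite S then ereal (real (card S)) else \<infinity>)"

definition upper_density :: "nat \<Rightarrow> (nat \<Rightarrow> (real \<times> real) set) \<Rightarrow> ereal" where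
  "upper_density N \<Lambda> = Limsup at_top (\<lambda>R::real.
      (SUP ab\<in>UNIV. \<Sum>n\<in>{1..N}. ecard (\<Lambda> n \<inter> Qsq (fst ab) (snd ab) R)) / ereal ((2 * R)\<^sup>2))"

end

theory Submission
  imports Defs
begin

text \<open>
  Every element e_j of the system with index in a square Q(R) is approximated, with an
  error at most \<epsilon> independent of j, by the span of those time-frequency shifts of the
  indicator of [0,1) whose integer lattice points lie in a slightly larger square Q(R + S).
  These shifts \<phi>_k are orthonormal and there are at most (2R + 2S + 2)^2 of them.
  Uniform minimality provides dual vectors h_j of norm at most 1/\<delta> in the span V of the
  e_j. With P and Q the orthogonal projections onto the span of the \<phi>_k and onto V, computing
  the trace of PQ in two ways gives \<Sum>_j <P e_j, h_j> = \<Sum>_k <Q \<phi>_k, \<phi>_k>.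
  The right side is at most the number of lattice points, while each term on the left has real
  part at least 1 - \<epsilon>/\<delta>.

  The uniform approximation reduces to shifts in the unit square by translating along the lattice;
  there it follows by compactness from the strong continuity of the shifts and the completeness of
  the \<phi>_k.
\<close>

subsection \<open>The space of square-integrable functions\<close>

text \<open>The bound 1 comes from the comparison system: the integer lattice has one point per unit
  area and its shifts of the indicator of [0,1) form an orthonormal basis. The margin S depends on
  \<epsilon> and the windows, but neither on the position nor on the size of the square. So (2R + 2S
  + 2)^2 / (2R)^2 tends to 1 for fixed \<epsilon>, and only afterwards is \<epsilon> made small
  compared with \<delta>. This order of limits is why the approximation must be uniform over all
  shifts of a window, and not merely available for each of them. Only finite subfamilies are ever
  compared: all spans are finite-dimensional, projections are finite sums, and an infinite point
  count is excluded because all finite subsets obey the same bound. Functions are not identified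
  almost everywhere; equality in L^2 appears through vanishing norms and inner products.\<close>

definition L2_inner :: "(real \<Rightarrow> complex) \<Rightarrow> (real \<Rightarrow> complex) \<Rightarrow> complex" where
  "L2_inner f g = (LINT t|lborel. f t * cnj (g t))"

lemma in_L2_borel [measurable_dest]: "in_L2 f \<Longrightarrow> f \<in> borel_measurable lborel"
  by (simp add: in_L2_def)

lemma borel_measurable_cnj [measurable]: "cnj \<in> borel_measurable borel"
  by (intro borel_measurable_continuous_onI continuous_intros)

lemma in_L2_square_integrable: "in_L2 f \<Longrightarrow> integrable lborel (\<lambda>t. (cmod (f t))\<^sup>2)"
  by (simp add: in_L2_def)

lemma in_L2_bound:
  assumes "f \<in> borel_measurable lborel" "integrable lborel w"
    and "\<And>t. (cmod (f t))\<^sup>2 \<le> w t"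
  shows "in_L2 f"
  unfolding in_L2_def
proof
  show "integrable lborel (\<lambda>t. (cmod (f t))\<^sup>2)"
  proof (rule Bochner_Integration.integrable_bound[OF assms(2)])
    show "(\<lambda>t. (cmod (f t))\<^sup>2) \<in> borel_measurable lborel"
      using assms(1) by measurable
    show "AE t in lborel. norm ((cmod (f t))\<^sup>2) \<le> norm (w t)"
    proof (rule AE_I2)
      fix t show "norm ((cmod (f t))\<^sup>2) \<le> norm (w t)"
        using assms(3)[of t] by simp
    qed
  qed
qed (fact assms)

lemma in_L2_scale: "in_L2 f \<Longrightarrow> in_L2 (\<lambda>t. c * f t)"
  by (auto simp: in_L2_def norm_mult power_mult_distrib)

lemma in_L2_zero: "in_L2 (\<lambda>t. 0)"
  by (simp add: in_L2_def)

lemma norm_add_square_le: "(norm (x + y))\<^sup>2 \<le> 2 * (norm x)\<^sup>2 + 2 * (norm y)\<^sup>2"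
  for x y :: "'a::real_normed_vector"
proof -
  have "(norm (x + y))\<^sup>2 \<le> (norm x + norm y)\<^sup>2"
    by (simp add: norm_triangle_ineq power_mono)
  also have "\<dots> \<le> 2 * (norm x)\<^sup>2 + 2 * (norm y)\<^sup>2"
    using sum_squares_bound[of "norm x" "norm y"] by (simp add: power2_sum)
  finally show ?thesis .
qed

lemma in_L2_add:
  assumes "in_L2 f" "in_L2 g"
  shows "in_L2 (\<lambda>t. f t + g t)"
proof (rule in_L2_bound)
  show "(\<lambda>t. f t + g t) \<in> borel_measurable lborel"
    using assms by (auto simp: in_L2_def)
  show "integrable lborel (\<lambda>t. 2 * (cmod (f t))\<^sup>2 + 2 * (cmod (g t))\<^sup>2)"
    using assms by (auto simp: in_L2_def)
qed (rule norm_add_square_le)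

lemma in_L2_diff:
  assumes "in_L2 f" "in_L2 g"
  shows "in_L2 (\<lambda>t. f t - g t)"
  using in_L2_add[OF assms(1) in_L2_scale[OF assms(2), of "-1"]] by simp

lemma in_L2_sum:
  assumes "\<And>i. i \<in> F \<Longrightarrow> in_L2 (f i)"
  shows "in_L2 (\<lambda>t. \<Sum>i\<in>F. f i t)"
  using assms
  by (induction F rule: infinite_finite_induct) (auto intro: in_L2_add in_L2_zero)

lemmas in_L2_intros = in_L2_add in_L2_diff in_L2_sum in_L2_scale in_L2_zero

section \<open>Sesquilinearity of the inner product\<close>

lemma integrable_L2_inner:
  assumes "in_L2 f" "in_L2 g"
  shows "integrable lborel (\<lambda>t. f t * cnj (g t))"
proof (rule Bochner_Integration.integrable_bound)
  show "integrable lborel (\<lambda>t. (cmod (f t))\<^sup>2 + (cmod (g t))\<^sup>2)"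
    using assms by (auto simp: in_L2_def)
  have [measurable]: "f \<in> borel_measurable lborel" "g \<in> borel_measurable lborel"
    using assms by (auto simp: in_L2_def)
  show "(\<lambda>t. f t * cnj (g t)) \<in> borel_measurable lborel"
    by measurable
  have "cmod (f t) * cmod (g t) \<le> (cmod (f t))\<^sup>2 + (cmod (g t))\<^sup>2" for t
    using sum_squares_bound[of "cmod (f t)" "cmod (g t)"]
      mult_nonneg_nonneg[OF norm_ge_zero norm_ge_zero, of "f t" "g t"] by linarith
  then show "AE t in lborel. norm (f t * cnj (g t)) \<le> norm ((cmod (f t))\<^sup>2 + (cmod (g t))\<^sup>2)"
    by (simp add: norm_mult)
qed

lemma L2_inner_add_left:
  "in_L2 f \<Longrightarrow> in_L2 g \<Longrightarrow> in_L2 h \<Longrightarrow>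
    L2_inner (\<lambda>t. f t + g t) h = L2_inner f h + L2_inner g h"
  by (simp add: L2_inner_def ring_distribs integrable_L2_inner)

lemma L2_inner_commute: "L2_inner g f = cnj (L2_inner f g)"
  unfolding L2_inner_def
  by (subst Bochner_Integration.integral_cnj[symmetric]) (simp add: mult.commute)

lemma L2_inner_add_right:
  "in_L2 f \<Longrightarrow> in_L2 g \<Longrightarrow> in_L2 h \<Longrightarrow>
    L2_inner h (\<lambda>t. f t + g t) = L2_inner h f + L2_inner h g"
  by (subst (1 2 3) L2_inner_commute) (simp add: L2_inner_add_left)

lemma L2_inner_diff_left:
  "in_L2 f \<Longrightarrow> in_L2 g \<Longrightarrow> in_L2 h \<Longrightarrow>
    L2_inner (\<lambda>t. f t - g t) h = L2_inner f h - L2_inner g h"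
  by (simp add: L2_inner_def ring_distribs integrable_L2_inner)

lemma L2_inner_scale_left: "L2_inner (\<lambda>t. c * f t) h = c * L2_inner f h"
  by (simp add: L2_inner_def mult.assoc)

lemma L2_inner_diff_right:
  "in_L2 f \<Longrightarrow> in_L2 g \<Longrightarrow> in_L2 h \<Longrightarrow>
    L2_inner h (\<lambda>t. f t - g t) = L2_inner h f - L2_inner h g"
  by (subst (1 2 3) L2_inner_commute) (simp add: L2_inner_diff_left)

lemma L2_inner_scale_right: "L2_inner h (\<lambda>t. c * f t) = cnj c * L2_inner h f"
  by (subst (1 2) L2_inner_commute) (simp add: L2_inner_scale_left)

lemma L2_inner_sum_left:
  assumes "\<And>i. i \<in> F \<Longrightarrow> in_L2 (e i)" "in_L2 h"
  shows "L2_inner (\<lambda>t. \<Sum>i\<in>F. c i * e i t) h = (\<Sum>i\<in>F. c i * L2_inner (e i) h)"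
  using assms(1)
  by (induction F rule: infinite_finite_induct)
    (auto simp: L2_inner_add_left L2_inner_scale_left in_L2_intros assms(2), simp_all add: L2_inner_def)

lemma L2_inner_sum_right:
  assumes "\<And>i. i \<in> F \<Longrightarrow> in_L2 (e i)" "in_L2 h"
  shows "L2_inner h (\<lambda>t. \<Sum>i\<in>F. c i * e i t) = (\<Sum>i\<in>F. cnj (c i) * L2_inner h (e i))"
  by (subst (1 2) L2_inner_commute) (simp add: L2_inner_sum_left assms)

section \<open>Norm inequalities and dominated convergence\<close>

lemma L2_norm_nonneg: "0 \<le> L2_norm f"
  by (simp add: L2_norm_def)

lemma L2_norm_square: "(L2_norm f)\<^sup>2 = (LINT t|lborel. (cmod (f t))\<^sup>2)"
  by (simp add: L2_norm_def)

lemma L2_inner_self: "L2_inner f f = of_real ((L2_norm f)\<^sup>2)"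
  unfolding L2_norm_square L2_inner_def integral_complex_of_real[symmetric]
  by (rule Bochner_Integration.integral_cong)
    (simp_all only: complex_norm_square refl)

lemma L2_norm_scale: "L2_norm (\<lambda>t. c * f t) = cmod c * L2_norm f"
  by (simp add: L2_norm_def norm_mult power_mult_distrib real_sqrt_mult)

lemma L2_norm_minus_commute: "L2_norm (\<lambda>t. f t - g t) = L2_norm (\<lambda>t. g t - f t)"
  by (simp add: L2_norm_def norm_minus_commute)

lemma L2_norm_mono:
  assumes "f \<in> borel_measurable lborel" "in_L2 g" "\<And>t. cmod (f t) \<le> cmod (g t)"
  shows "in_L2 f" "L2_norm f \<le> L2_norm g"
proof -
  have *: "(cmod (f t))\<^sup>2 \<le> (cmod (g t))\<^sup>2" for t
    using assms(3) by (simp add: power_mono)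
  show f: "in_L2 f"
    using * assms(2) by (intro in_L2_bound[OF assms(1)]) (auto simp: in_L2_def)
  show "L2_norm f \<le> L2_norm g"
    unfolding L2_norm_def using f assms(2) *
    by (intro real_sqrt_le_mono integral_mono) (auto simp: in_L2_def)
qed

text \<open>The Cauchy-Schwarz inequality is taken for extended nonnegative integrals of the moduli
  and then carried back to real integrals.\<close>

lemma L2_inner_le:
  assumes f: "in_L2 f" and g: "in_L2 g"
  shows "cmod (L2_inner f g) \<le> L2_norm f * L2_norm g"
proof -
  have [measurable]: "f \<in> borel_measurable lborel" "g \<in> borel_measurable lborel"
    using assms by (auto simp: in_L2_def)
  let ?I = "LINT t|lborel. cmod (f t) * cmod (g t)"
  have int: "integrable lborel (\<lambda>t. cmod (f t) * cmod (g t))"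
    using integrable_norm[OF integrable_L2_inner[OF assms]] by (simp add: norm_mult)
  have nn: "(\<integral>\<^sup>+t. ennreal (cmod (f t)) ^ 2 \<partial>lborel) = ennreal ((L2_norm f)\<^sup>2)"
    if "in_L2 f" for f
    using that unfolding L2_norm_square
    by (subst nn_integral_eq_integral[symmetric]) (auto simp: in_L2_def ennreal_power)
  have "(\<integral>\<^sup>+t. ennreal (cmod (f t)) * ennreal (cmod (g t)) \<partial>lborel)\<^sup>2
      \<le> ennreal ((L2_norm f)\<^sup>2) * ennreal ((L2_norm g)\<^sup>2)"
    unfolding nn[OF f, symmetric] nn[OF g, symmetric]
    by (rule Cauchy_Schwarz_nn_integral) auto
  moreover have "(\<integral>\<^sup>+t. ennreal (cmod (f t)) * ennreal (cmod (g t)) \<partial>lborel) = ennreal ?I"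
    using int by (subst nn_integral_eq_integral[symmetric]) (auto simp: ennreal_mult)
  ultimately have "?I\<^sup>2 \<le> (L2_norm f * L2_norm g)\<^sup>2"
    by (simp add: ennreal_power ennreal_mult[symmetric] power_mult_distrib)
  then have "?I \<le> L2_norm f * L2_norm g"
    by (rule power2_le_imp_le) (simp add: L2_norm_nonneg)
  moreover have "cmod (L2_inner f g) \<le> ?I"
    unfolding L2_inner_def using integral_norm_bound[of lborel "\<lambda>t. f t * cnj (g t)"]
    by (simp add: norm_mult)
  ultimately show ?thesis by simp
qed

lemma L2_norm_add_square:
  assumes "in_L2 f" "in_L2 g"
  shows "(L2_norm (\<lambda>t. f t + g t))\<^sup>2 = (L2_norm f)\<^sup>2 + 2 * Re (L2_inner f g) + (L2_norm g)\<^sup>2"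
proof -
  have "complex_of_real ((L2_norm (\<lambda>t. f t + g t))\<^sup>2) =
      L2_inner f f + (L2_inner f g + L2_inner g f) + L2_inner g g"
    unfolding L2_inner_self[symmetric]
    by (simp add: L2_inner_add_left L2_inner_add_right in_L2_intros assms)
  then have "Re (complex_of_real ((L2_norm (\<lambda>t. f t + g t))\<^sup>2)) =
      Re (L2_inner f f + (L2_inner f g + L2_inner g f) + L2_inner g g)"
    by simp
  then show ?thesis
    unfolding L2_inner_self using L2_inner_commute[of g f] by simp
qed

lemma L2_norm_triangle:
  assumes "in_L2 f" "in_L2 g"
  shows "L2_norm (\<lambda>t. f t + g t) \<le> L2_norm f + L2_norm g"
proof (rule power2_le_imp_le)
  show "(L2_norm (\<lambda>t. f t + g t))\<^sup>2 \<le> (L2_norm f + L2_norm g)\<^sup>2"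
    using L2_inner_le[OF assms] complex_Re_le_cmod[of "L2_inner f g"]
    by (simp add: L2_norm_add_square assms power2_sum)
qed (simp add: L2_norm_nonneg)

lemma L2_norm_diff_triangle:
  assumes "in_L2 f" "in_L2 g" "in_L2 h"
  shows "L2_norm (\<lambda>t. f t - h t) \<le> L2_norm (\<lambda>t. f t - g t) + L2_norm (\<lambda>t. g t - h t)"
  using L2_norm_triangle[of "\<lambda>t. f t - g t" "\<lambda>t. g t - h t"] assms by (simp add: in_L2_intros)

text \<open>The majorant is imposed on the squared error, so that scalar dominated convergence
  applies to it directly.\<close>

lemma L2_dominated_convergence:
  fixes s :: "nat \<Rightarrow> real \<Rightarrow> complex" and w :: "real \<Rightarrow> real"
  assumes [measurable]: "f \<in> borel_measurable lborel" "\<And>n. s n \<in> borel_measurable lborel"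
    and w: "integrable lborel w"
    and lim: "AE t in lborel. (\<lambda>n. s n t) \<longlonglongrightarrow> f t"
    and bound: "\<And>n t. (cmod (s n t - f t))\<^sup>2 \<le> w t"
  shows "(\<lambda>n. L2_norm (\<lambda>t. s n t - f t)) \<longlonglongrightarrow> 0"
proof -
  have "(\<lambda>n. LINT t|lborel. (cmod (s n t - f t))\<^sup>2) \<longlonglongrightarrow> (LINT t|(lborel :: real measure). (0::real))"
  proof (rule integral_dominated_convergence[where w = w])
    show "AE t in lborel. (\<lambda>n. (cmod (s n t - f t))\<^sup>2) \<longlonglongrightarrow> 0"
      using lim by eventually_elim (auto intro!: tendsto_eq_intros)
    show "AE t in lborel. norm ((cmod (s n t - f t))\<^sup>2) \<le> w t" for n
      using bound by simp
  qed (use w in simp_all)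
  then show ?thesis
    unfolding L2_norm_def using tendsto_real_sqrt by fastforce
qed

subsection \<open>Density of step functions\<close>

lemma in_L2_indicator_iff:
  assumes "A \<in> sets borel"
  shows "in_L2 (indicator A) \<longleftrightarrow> emeasure lborel A < \<infinity>"
proof -
  have "(\<lambda>t. (cmod (indicator A t))\<^sup>2) = (indicator A :: real \<Rightarrow> real)"
    by (auto simp: indicator_def)
  then show ?thesis
    using assms by (simp add: in_L2_def integrable_indicator_iff)
qed

lemma in_L2_indicator_interval: "in_L2 (indicator {c..d})"
  by (subst in_L2_indicator_iff) (auto simp: emeasure_lborel_Icc_eq)

text \<open>A property of L^2 functions that is linear and closed under norm limits need only be
  checked on compact intervals. It passes to bounded Borel sets by a Dynkin argument, then to sets
  of finite measure, simple functions and all of L^2. It serves both the completeness of the Gabor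
  system and the strong continuity of the shifts.\<close>

lemma L2_induct [consumes 1, case_names interval add scale lim]:
  assumes f: "in_L2 f"
    and interval: "\<And>c d. P (indicator {c..d})"
    and add: "\<And>f g. in_L2 f \<Longrightarrow> in_L2 g \<Longrightarrow> P f \<Longrightarrow> P g \<Longrightarrow> P (\<lambda>t. f t + g t)"
    and scale: "\<And>c f. in_L2 f \<Longrightarrow> P f \<Longrightarrow> P (\<lambda>t. c * f t)"
    and lim: "\<And>f s. in_L2 f \<Longrightarrow> (\<And>n::nat. in_L2 (s n)) \<Longrightarrow> (\<And>n. P (s n)) \<Longrightarrow>
      (\<lambda>n. L2_norm (\<lambda>t. s n t - f t)) \<longlonglongrightarrow> 0 \<Longrightarrow> P f"
  shows "P f"
proof -
  \<comment> \<open>The interval from 1 to 0 is empty.\<close>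
  have zero: "P (\<lambda>t. 0)"
    using interval[of 1 0] by (simp add: indicator_def[abs_def])
  \<comment> \<open>Complements in the line would leave L^2; inside a window {-M..M} they are
    differences of two L^2 indicators.\<close>
  have bounded: "P (indicator (A \<inter> {-M..M}))" if "A \<in> sets borel" for A and M :: real
  proof -
    have fin: "in_L2 (indicator (A \<inter> {-M..M}))" if [measurable]: "A \<in> sets borel" for A
      by (rule L2_norm_mono[OF _ in_L2_indicator_interval[of "-M" M]])
        (auto simp: indicator_def that)
    have borel: "sigma_sets UNIV (range (\<lambda>a::real. {..a})) = sets borel"
      unfolding borel_eq_atMost by simp
    \<comment> \<open>The half-lines form an intersection-stable generator, so only complements and
      disjoint unions have to be treated.\<close>
    have "Int_stable (range (\<lambda>a::real. {..a}))"
      by (auto simp: Int_stable_def)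
    moreover have "range (\<lambda>a::real. {..a}) \<subseteq> Pow UNIV"
      by simp
    moreover have "A \<in> sigma_sets UNIV (range (\<lambda>a::real. {..a}))"
      using that unfolding borel_eq_atMost by simp
    ultimately show ?thesis
    proof (induction rule: sigma_sets_induct_disjoint)
      case (basic A)
      then obtain a where "A = {..a}" by auto
      then have "A \<inter> {-M..M} = {-M..min a M}" by auto
      then show ?case using interval by simp
    next
      case empty
      then show ?case using zero by (simp add: indicator_def[abs_def])
    next
      case (compl A)
      note compl = compl[unfolded borel]
      have "P (\<lambda>t. indicator {-M..M} t + (-1) * indicator (A \<inter> {-M..M}) t)"
        using compl fin by (intro add scale interval in_L2_scale in_L2_indicator_interval) auto
      moreover have "(\<lambda>t. indicator {-M..M} t + (-1) * indicator (A \<inter> {-M..M}) t) =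
          (indicator ((UNIV - A) \<inter> {-M..M}) :: real \<Rightarrow> complex)"
        by (auto simp: indicator_def)
      ultimately show ?case by simp
    next
      case (union A)
      note union = union[unfolded borel]
      define s where "s n = (indicator (\<Union>i<n. A i \<inter> {-M..M}) :: real \<Rightarrow> complex)" for n :: nat
      have [measurable]: "A i \<in> sets borel" for i
        using union by auto
      have s: "P (s n)" for n
      proof (induction n)
        case 0
        then show ?case using zero by (simp add: indicator_def[abs_def] s_def)
      next
        case (Suc n)
        have disj: "(\<Union>i<n. A i \<inter> {-M..M}) \<inter> (A n \<inter> {-M..M}) = {}"
        proof -
          have "A i \<inter> A n = {}" if "i < n" for i
            using disjoint_family_onD[OF union(1), of i n] that by simp
          then show ?thesis by blast
        qed
        have "s (Suc n) = (\<lambda>t. s n t + indicator (A n \<inter> {-M..M}) t)"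
          unfolding s_def indicator_add[OF disj] by (simp add: lessThan_Suc Un_commute)
        moreover have "in_L2 (s n)"
          using fin[of "\<Union>i<n. A i"] unfolding s_def by (simp add: Int_UN_distrib2)
        ultimately show ?case
          using Suc union fin by (auto intro!: add)
      qed
      have eq: "(\<Union>i. A i \<inter> {-M..M}) = (\<Union>i. A i) \<inter> {-M..M}"
        by auto
      have "P (indicator (\<Union>i. A i \<inter> {-M..M}))"
      proof (rule lim[where s = s])
        show "in_L2 (indicator (\<Union>i. A i \<inter> {-M..M}))"
          unfolding eq by (rule fin) measurable
        show "in_L2 (s n)" for n
          using fin[of "\<Union>i<n. A i"] unfolding s_def by (simp add: Int_UN_distrib2)
        show "P (s n)" for n by (rule s)
        show "(\<lambda>n. L2_norm (\<lambda>t. s n t - indicator (\<Union>i. A i \<inter> {-M..M}) t)) \<longlonglongrightarrow> 0"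
        proof (rule L2_dominated_convergence[where w = "indicator {-M..M}"])
          show "AE t in lborel. (\<lambda>n. s n t) \<longlonglongrightarrow> indicator (\<Union>i. A i \<inter> {-M..M}) t"
            unfolding s_def by (intro AE_I2 LIMSEQ_indicator_UN)
          show "(cmod (s n t - indicator (\<Union>i. A i \<inter> {-M..M}) t))\<^sup>2 \<le> indicator {-M..M} t" for n t
            by (auto simp: indicator_def s_def)
        qed (auto simp: s_def emeasure_lborel_Icc_eq)
      qed
      then show ?case unfolding eq .
    qed
  qed
  have finite_measure: "P (indicator A)"
    if [measurable]: "A \<in> sets borel" and A: "in_L2 (indicator A)" for A
  proof (rule lim[where s = "\<lambda>n. indicator (A \<inter> {-real n..real n})"])
    show "in_L2 (indicator (A \<inter> {-real n..real n}))" for n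
      by (rule L2_norm_mono[OF _ A]) (auto simp: indicator_def)
    show "(\<lambda>n. L2_norm (\<lambda>t. indicator (A \<inter> {-real n..real n}) t - indicator A t)) \<longlonglongrightarrow> 0"
    proof (rule L2_dominated_convergence[where w = "\<lambda>t. (cmod (indicator A t))\<^sup>2"])
      have "(\<lambda>n. indicator (A \<inter> {-real n..real n}) t :: complex) \<longlonglongrightarrow> indicator A t" for t
      proof (rule tendsto_eventually)
        have "indicator (A \<inter> {-real n..real n}) t = (indicator A t :: complex)" if "n \<ge> nat \<lceil>\<bar>t\<bar>\<rceil>" for n
          using that by (auto simp: indicator_def)
        then show "\<forall>\<^sub>F n in sequentially. indicator (A \<inter> {-real n..real n}) t = (indicator A t :: complex)"
          unfolding eventually_sequentially by blast
      qed
      then show "AE t in lborel. (\<lambda>n. indicator (A \<inter> {-real n..real n}) t :: complex) \<longlonglongrightarrow> indicator A t"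
        by simp
      show "(cmod (indicator (A \<inter> {-real n..real n}) t - indicator A t))\<^sup>2 \<le> (cmod (indicator A t))\<^sup>2" for n t
        by (auto simp: indicator_def)
      show "integrable lborel (\<lambda>t. (cmod (indicator A t))\<^sup>2)"
        using A by (rule in_L2_square_integrable)
      show "indicator (A \<inter> {-real n..real n}) \<in> borel_measurable lborel" for n
        by measurable
    qed measurable
  qed (use bounded that in auto)
  have sum: "in_L2 (\<lambda>t. \<Sum>i\<in>F. h i t) \<and> P (\<lambda>t. \<Sum>i\<in>F. h i t)"
    if "finite F" "\<And>i. i \<in> F \<Longrightarrow> in_L2 (h i) \<and> P (h i)" for F and h :: "complex \<Rightarrow> real \<Rightarrow> complex"
    using that by (induction F) (auto intro: zero in_L2_zero add in_L2_add)
  have simple: "P s" if s: "simple_function lborel s" "in_L2 s" for s :: "real \<Rightarrow> complex"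
  proof -
    let ?h = "\<lambda>y t. y * indicator (s -` {y}) t"
    have fin: "finite (range s)"
      using simple_functionD(1)[OF s(1)] by simp
    \<comment> \<open>The value 0 is left out because its level set may have infinite
      measure.\<close>
    have "in_L2 (?h y) \<and> P (?h y)" if y: "y \<in> range s - {0}" for y
    proof -
      have [measurable]: "s -` {y} \<in> sets borel"
        using simple_functionD(2)[OF s(1), of "{y}"] by simp
      \<comment> \<open>On this level set s / y equals 1, so the indicator is dominated by an L^2
        function.\<close>
      have "in_L2 (indicator (s -` {y}))"
        by (rule L2_norm_mono[OF _ in_L2_scale[OF s(2), of "inverse y"]])
          (use y in \<open>auto simp: indicator_def norm_mult norm_inverse\<close>)
      then show ?thesis
        by (intro conjI scale finite_measure in_L2_scale) auto
    qed
    then have "P (\<lambda>t. \<Sum>y\<in>range s - {0}. ?h y t)"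
      using sum[of "range s - {0}" ?h] fin by blast
    moreover have "(\<Sum>y\<in>range s - {0}. ?h y t) = s t" for t
    proof -
      have "(\<Sum>y\<in>range s - {0}. ?h y t) = (\<Sum>y\<in>range s. if s t = y then y else 0)"
        using fin by (intro sum.mono_neutral_cong_left) (auto simp: indicator_def)
      then show ?thesis using fin by simp
    qed
    ultimately show ?thesis by simp
  qed
  obtain s where s: "\<And>i. simple_function lborel (s i)" "\<And>x. (\<lambda>i. s i x) \<longlonglongrightarrow> f x"
      "\<And>i x. cmod (s i x) \<le> 2 * cmod (f x)"
    using borel_measurable_implies_sequence_metric[OF in_L2_borel[OF f], of 0] by auto
  have [measurable]: "s i \<in> borel_measurable lborel" for i
    using s(1) by (rule borel_measurable_simple_function)
  have L2: "in_L2 (s i)" for i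
    by (rule L2_norm_mono[OF _ in_L2_scale[OF f, of 2]]) (auto simp: s norm_mult)
  show ?thesis
  proof (rule lim[OF f, where s = s])
    show "(\<lambda>n. L2_norm (\<lambda>t. s n t - f t)) \<longlonglongrightarrow> 0"
    \<comment> \<open>The approximants satisfy |s| <= 2|f|, hence |s - f| <= 3|f|.\<close>
    proof (rule L2_dominated_convergence[where w = "\<lambda>t. 9 * (cmod (f t))\<^sup>2"])
      show "(cmod (s n t - f t))\<^sup>2 \<le> 9 * (cmod (f t))\<^sup>2" for n t
      proof -
        have "cmod (s n t - f t) \<le> 3 * cmod (f t)"
          using norm_triangle_ineq4[of "s n t" "f t"] s(3)[of n t] by linarith
        then have "(cmod (s n t - f t))\<^sup>2 \<le> (3 * cmod (f t))\<^sup>2"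
          by (rule power_mono) simp
        then show ?thesis by (simp add: power_mult_distrib)
      qed
    qed (use f s in \<open>auto simp: in_L2_def\<close>)
  qed (use simple s L2 in auto)
qed

subsection \<open>Dual families and oblique projections\<close>

text \<open>If h is dual to e and spans the same space, this is the orthogonal projection onto that space.\<close>

definition oblique_proj ::
    "'i set \<Rightarrow> ('i \<Rightarrow> real \<Rightarrow> complex) \<Rightarrow> ('i \<Rightarrow> real \<Rightarrow> complex) \<Rightarrow> (real \<Rightarrow> complex) \<Rightarrow> real \<Rightarrow> complex" where
  "oblique_proj J e h f = (\<lambda>t. \<Sum>j\<in>J. L2_inner f (h j) * e j t)"

text \<open>The last clause says that \<open>oblique_proj J e h\<close> leaves a residual orthogonal
  to the span of e. It is carried along as an invariant because the inductive construction projects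
  each new vector with it.\<close>

definition dual_family :: "'i set \<Rightarrow> ('i \<Rightarrow> real \<Rightarrow> complex) \<Rightarrow> ('i \<Rightarrow> real \<Rightarrow> complex) \<Rightarrow> bool" where
  "dual_family J e h \<longleftrightarrow>
    (\<forall>j\<in>J. in_L2 (e j) \<and> (\<exists>c. h j = (\<lambda>t. \<Sum>i\<in>J. c i * e i t))) \<and>
    (\<forall>i\<in>J. \<forall>j\<in>J. L2_inner (e i) (h j) = (if i = j then 1 else 0)) \<and>
    (\<forall>f. in_L2 f \<longrightarrow> (\<forall>i\<in>J. L2_inner (\<lambda>t. f t - oblique_proj J e h f t) (e i) = 0))"

lemma in_L2_oblique_proj:
  "(\<And>j. j \<in> J \<Longrightarrow> in_L2 (e j)) \<Longrightarrow> in_L2 (oblique_proj J e h f)"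
  unfolding oblique_proj_def by (intro in_L2_sum in_L2_scale)

lemma dual_family_in_L2:
  assumes "dual_family J e h" "j \<in> J"
  shows "in_L2 (e j)" "in_L2 (h j)"
proof -
  have e: "\<And>i. i \<in> J \<Longrightarrow> in_L2 (e i)"
    using assms by (auto simp: dual_family_def)
  then show "in_L2 (e j)" using assms by simp
  obtain c where "h j = (\<lambda>t. \<Sum>i\<in>J. c i * e i t)"
    using assms unfolding dual_family_def by blast
  then show "in_L2 (h j)"
    using e by (auto intro!: in_L2_sum in_L2_scale)
qed

text \<open>An orthonormal family is its own dual, so the facts about \<open>oblique_proj\<close>
  serve both projections in the trace comparison.\<close>

lemma dual_family_orthonormal:
  assumes "finite J" "\<And>j. j \<in> J \<Longrightarrow> in_L2 (e j)"
    and "\<And>i j. i \<in> J \<Longrightarrow> j \<in> J \<Longrightarrow> L2_inner (e i) (e j) = (if i = j then 1 else 0)"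
  shows "dual_family J e e"
  unfolding dual_family_def
proof (intro conjI allI impI ballI)
  fix j assume j: "j \<in> J"
  have "e j = (\<lambda>t. \<Sum>i\<in>J. (if i = j then 1 else 0) * e i t)"
    using j \<open>finite J\<close> by (simp add: if_distrib[of "\<lambda>x. x * _"] cong: if_cong)
  then show "\<exists>c. e j = (\<lambda>t. \<Sum>i\<in>J. c i * e i t)"
    by (intro exI[where x = "\<lambda>i. if i = j then 1 else 0"])
next
  fix f i assume "in_L2 f" "i \<in> J"
  then show "L2_inner (\<lambda>t. f t - oblique_proj J e e f t) (e i) = 0"
    using assms
    by (simp add: L2_inner_diff_left in_L2_oblique_proj)
      (simp add: oblique_proj_def L2_inner_sum_left if_distrib[of "\<lambda>x. _ * x"] cong: if_cong)
qed (use assms in auto)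

lemma L2_inner_oblique_proj_residual:
  assumes "dual_family J e h" "in_L2 f"
  shows "L2_inner (\<lambda>t. f t - oblique_proj J e h f t) (\<lambda>t. \<Sum>j\<in>J. c j * e j t) = 0"
  using assms dual_family_in_L2[OF assms(1)]
  by (subst L2_inner_sum_right) (auto simp: in_L2_intros in_L2_oblique_proj dual_family_def)

text \<open>Pythagoras: the residual is orthogonal to the projection, so its squared norm is its
  inner product with f.\<close>

lemma L2_norm_oblique_proj:
  assumes "dual_family J e h" "in_L2 f"
  shows "(L2_norm (\<lambda>t. f t - oblique_proj J e h f t))\<^sup>2 =
    (L2_norm f)\<^sup>2 - Re (L2_inner (oblique_proj J e h f) f)"
proof -
  let ?p = "oblique_proj J e h f"
  have p: "in_L2 ?p"
    using dual_family_in_L2(1)[OF assms(1)] by (rule in_L2_oblique_proj)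
  have "L2_inner (\<lambda>t. f t - ?p t) (\<lambda>t. f t - ?p t) = L2_inner (\<lambda>t. f t - ?p t) f"
    using L2_inner_oblique_proj_residual[OF assms, of "\<lambda>j. L2_inner f (h j)"] assms(2) p
    by (simp add: L2_inner_diff_right in_L2_diff oblique_proj_def)
  also have "\<dots> = L2_inner f f - L2_inner ?p f"
    using assms(2) p by (simp add: L2_inner_diff_left)
  finally have "complex_of_real ((L2_norm (\<lambda>t. f t - ?p t))\<^sup>2) =
      of_real ((L2_norm f)\<^sup>2) - L2_inner ?p f"
    by (simp only: L2_inner_self)
  then have "Re (complex_of_real ((L2_norm (\<lambda>t. f t - ?p t))\<^sup>2)) =
      Re (of_real ((L2_norm f)\<^sup>2) - L2_inner ?p f)"
    by (rule arg_cong)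
  then show ?thesis
    by simp
qed

lemma Re_L2_inner_oblique_proj_le:
  assumes "dual_family J e h" "in_L2 f"
  shows "Re (L2_inner (oblique_proj J e h f) f) \<le> (L2_norm f)\<^sup>2"
  using L2_norm_oblique_proj[OF assms] zero_le_power2[of "L2_norm (\<lambda>t. f t - oblique_proj J e h f t)"]
  by linarith

text \<open>One step of the Gram-Schmidt process, carried out on the dual family.\<close>

lemma dual_family_insert:
  assumes J: "finite J" "k \<notin> J" and d: "dual_family J e h" and ek: "in_L2 (e k)"
    and pos: "\<And>c. L2_norm (\<lambda>t. e k t - (\<Sum>j\<in>J. c j * e j t)) > 0"
  shows "\<exists>h'. dual_family (insert k J) e h'"
proof -
  have e: "in_L2 (e j)" and h: "in_L2 (h j)" if "j \<in> J" for j
    using dual_family_in_L2[OF d that] by auto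
  have bi: "L2_inner (e i) (h j) = (if i = j then 1 else 0)" if "i \<in> J" "j \<in> J" for i j
    using d that by (auto simp: dual_family_def)
  define p where "p = oblique_proj J e h (e k)"
  define r where "r = (\<lambda>t. e k t - p t)"
  define \<rho> where "\<rho> = (L2_norm r)\<^sup>2"
  have p: "in_L2 p" and r: "in_L2 r"
    unfolding r_def p_def using e ek by (auto intro!: in_L2_diff in_L2_oblique_proj)
  have "L2_norm r > 0"
    using pos[of "\<lambda>j. L2_inner (e k) (h j)"] by (simp add: r_def p_def oblique_proj_def)
  then have \<rho>: "\<rho> > 0" by (simp add: \<rho>_def)
  have r_span: "L2_inner r (\<lambda>t. \<Sum>j\<in>J. c j * e j t) = 0" for c
    unfolding r_def p_def by (rule L2_inner_oblique_proj_residual[OF d ek])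
  have r_e: "L2_inner r (e j) = 0" if "j \<in> J" for j
    using d that ek by (auto simp: dual_family_def r_def p_def)
  have e_r: "L2_inner (e j) r = 0" if "j \<in> J" for j
    using r_e[OF that] by (subst L2_inner_commute) simp
  have r_proj: "L2_inner r (oblique_proj J e h f) = 0" for f
    unfolding oblique_proj_def by (rule r_span)
  have proj_r: "L2_inner (oblique_proj J e h f) r = 0" for f
    using r_proj by (subst L2_inner_commute) simp
  \<comment> \<open>The new vector is r + p, and p is orthogonal to r.\<close>
  have ek_r: "L2_inner (e k) r = of_real \<rho>"
  proof -
    have "L2_inner r r = L2_inner (e k) r - L2_inner p r"
      using L2_inner_diff_left[OF ek p r] by (simp add: r_def)
    then show ?thesis
      using proj_r by (simp add: p_def \<rho>_def L2_inner_self)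
  qed
  \<comment> \<open>Since r is orthogonal to the old vectors and pairs with \<open>e k\<close> to
    \<rho>, the vector r / \<rho> is dual to \<open>e k\<close>. The old duals receive a multiple of
    it that cancels their pairing with \<open>e k\<close>; the conjugate is due to
    conjugate-linearity in the second argument.\<close>
  define h' where "h' j = (if j = k then (\<lambda>t. of_real (1 / \<rho>) * r t)
    else (\<lambda>t. h j t - cnj (L2_inner (e k) (h j)) * (of_real (1 / \<rho>) * r t)))" for j
  have inner_k: "L2_inner f (h' k) = L2_inner f r / of_real \<rho>" for f
    unfolding h'_def by (simp only: refl if_True L2_inner_scale_right) simp
  have inner_j: "L2_inner f (h' j) = L2_inner f (h j) - L2_inner (e k) (h j) * (L2_inner f r / of_real \<rho>)"
    if "j \<in> J" "in_L2 f" for j f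
  proof -
    have "j \<noteq> k" using that J by auto
    then show ?thesis
      using that r h by (simp only: h'_def if_False L2_inner_diff_right in_L2_scale L2_inner_scale_right) simp
  qed
  \<comment> \<open>The corrections recombine: the new projection is the old one plus the orthogonal
    projection onto the line through r.\<close>
  have proj: "oblique_proj (insert k J) e h' f = (\<lambda>t. oblique_proj J e h f t + (L2_inner f r / of_real \<rho>) * r t)"
    if f: "in_L2 f" for f
  proof
    fix t
    define a where "a = L2_inner f r / of_real \<rho>"
    have "oblique_proj (insert k J) e h' f t =
        a * e k t + (\<Sum>j\<in>J. (L2_inner f (h j) - L2_inner (e k) (h j) * a) * e j t)"
      unfolding oblique_proj_def a_def using J f by (simp add: inner_k inner_j)
    also have "(\<Sum>j\<in>J. (L2_inner f (h j) - L2_inner (e k) (h j) * a) * e j t) =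
        oblique_proj J e h f t - a * p t"
      unfolding p_def oblique_proj_def
      by (simp add: algebra_simps sum_subtractf sum_distrib_left)
    also have "a * e k t + (oblique_proj J e h f t - a * p t) = oblique_proj J e h f t + a * r t"
      by (simp add: r_def algebra_simps)
    finally show "oblique_proj (insert k J) e h' f t = oblique_proj J e h f t + (L2_inner f r / of_real \<rho>) * r t"
      unfolding a_def .
  qed
  have r_comb: "\<exists>c. r = (\<lambda>t. \<Sum>i\<in>insert k J. c i * e i t)"
  proof (intro exI ext)
    fix t
    show "r t = (\<Sum>i\<in>insert k J. (if i = k then 1 else - L2_inner (e k) (h i)) * e i t)"
      using J by (auto simp: r_def p_def oblique_proj_def sum_negf[symmetric] intro!: sum.cong)
  qed
  then obtain a where a: "r = (\<lambda>t. \<Sum>i\<in>insert k J. a i * e i t)" by blast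
  have "dual_family (insert k J) e h'"
    unfolding dual_family_def
  proof (intro conjI ballI allI impI)
    show "in_L2 (e j)" if "j \<in> insert k J" for j
      using that e ek by auto
    show "\<exists>c. h' j = (\<lambda>t. \<Sum>i\<in>insert k J. c i * e i t)" if "j \<in> insert k J" for j
    proof (cases "j = k")
      case True
      then have "h' j = (\<lambda>t. \<Sum>i\<in>insert k J. (of_real (1 / \<rho>) * a i) * e i t)"
        by (simp only: h'_def refl if_True a sum_distrib_left mult.assoc)
      then show ?thesis by (intro exI[where x = "\<lambda>i. of_real (1 / \<rho>) * a i"])
    next
      case False
      then have "j \<in> J" using that by simp
      then obtain b where b: "h j = (\<lambda>t. \<Sum>i\<in>J. b i * e i t)"
        using d by (auto simp: dual_family_def)
      define q where "q = cnj (L2_inner (e k) (h j)) * of_real (1 / \<rho>)"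
      have "h' j = (\<lambda>t. \<Sum>i\<in>insert k J. ((if i = k then 0 else b i) - q * a i) * e i t)"
      proof
        fix t
        have "h j t = (\<Sum>i\<in>insert k J. (if i = k then 0 else b i) * e i t)"
          using J by (auto simp: b intro!: sum.cong)
        moreover have "h' j t = h j t - q * r t"
          using False by (simp add: h'_def q_def)
        ultimately show "h' j t = (\<Sum>i\<in>insert k J. ((if i = k then 0 else b i) - q * a i) * e i t)"
          by (simp only: left_diff_distrib sum_subtractf a sum_distrib_left mult.assoc)
      qed
      then show ?thesis
        by (intro exI[where x = "\<lambda>i. (if i = k then 0 else b i) - q * a i"])
    qed
    show "L2_inner (e i) (h' j) = (if i = j then 1 else 0)" if "i \<in> insert k J" "j \<in> insert k J" for i j
    proof (cases "j = k")
      case True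
      then show ?thesis
        using that J \<rho> by (auto simp: inner_k ek_r e_r)
    next
      case False
      then have "j \<in> J" using that by simp
      then show ?thesis
        using that J \<rho> e ek bi by (auto simp: inner_j ek_r e_r)
    qed
    show "L2_inner (\<lambda>t. f t - oblique_proj (insert k J) e h' f t) (e i) = 0"
      if f: "in_L2 f" and i: "i \<in> insert k J" for f i
    proof -
      let ?s = "\<lambda>t. f t - oblique_proj (insert k J) e h' f t"
      have s: "?s = (\<lambda>t. (f t - oblique_proj J e h f t) - (L2_inner f r / of_real \<rho>) * r t)"
        using proj[OF f] by (simp add: fun_eq_iff algebra_simps)
      have Pf: "in_L2 (oblique_proj J e h f)"
        using e by (rule in_L2_oblique_proj)
      have inner: "L2_inner ?s g =
          L2_inner (\<lambda>t. f t - oblique_proj J e h f t) g - L2_inner f r / of_real \<rho> * L2_inner r g"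
        if "in_L2 g" for g
        unfolding s using that f r Pf
        by (subst L2_inner_diff_left) (simp_all only: in_L2_diff in_L2_scale L2_inner_scale_left)
      have on_J: "L2_inner ?s (\<lambda>t. \<Sum>j\<in>J. c j * e j t) = 0" for c
        using e by (subst inner) (auto intro!: in_L2_sum in_L2_scale
            simp: r_span L2_inner_oblique_proj_residual[OF d f])
      show ?thesis
      proof (cases "i = k")
        case True
        \<comment> \<open>The vector \<open>e k\<close> is r + p, so orthogonality to r and to p is
          enough.\<close>
        have "L2_inner ?s r = 0"
          using \<rho> f r Pf
          by (simp add: inner L2_inner_diff_left proj_r L2_inner_self) (simp add: \<rho>_def)
        moreover have "L2_inner ?s p = 0"
          unfolding p_def oblique_proj_def[of J e h "e k"] by (rule on_J)
        moreover have "L2_inner ?s (e k) = L2_inner ?s (\<lambda>t. r t + p t)"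
          by (simp add: r_def)
        moreover have "in_L2 ?s"
          unfolding s by (intro in_L2_diff in_L2_scale f r Pf)
        ultimately show ?thesis
          using True r p by (simp add: L2_inner_add_right)
      next
        case False
        then have "i \<in> J" using i by simp
        then show ?thesis
          using d f e by (subst inner) (auto simp: r_e dual_family_def)
      qed
    qed
  qed
  then show ?thesis by blast
qed

text \<open>Positive distance of each vector from the combinations of the others is linear
  independence in L^2, which is what Gram-Schmidt needs.\<close>

lemma dual_family_exists:
  assumes "finite J" "\<And>j. j \<in> J \<Longrightarrow> in_L2 (e j)"
    and "\<And>j c. j \<in> J \<Longrightarrow> L2_norm (\<lambda>t. e j t - (\<Sum>i\<in>J - {j}. c i * e i t)) > 0"
  shows "\<exists>h. dual_family J e h"
  using assms
proof (induction J)
  case empty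
  then show ?case by (simp add: dual_family_def)
next
  case (insert k J)
  have "\<exists>h. dual_family J e h"
  proof (rule insert.IH)
    fix j c assume j: "j \<in> J"
    \<comment> \<open>Coefficients extended by 0 at k turn the distance hypothesis for the larger
      family into the one for J.\<close>
    have "(\<Sum>i\<in>insert k J - {j}. (if i = k then 0 else c i) * e i t) = (\<Sum>i\<in>J - {j}. c i * e i t)" for t
      using insert(1,2) by (intro sum.mono_neutral_cong_right) auto
    then show "L2_norm (\<lambda>t. e j t - (\<Sum>i\<in>J - {j}. c i * e i t)) > 0"
      using insert.prems(2)[of j "\<lambda>i. if i = k then 0 else c i"] j by simp
  qed (use insert in auto)
  then obtain h where h: "dual_family J e h" ..
  show ?case
  proof (rule dual_family_insert[OF insert(1,2) h])
    fix c
    have "insert k J - {k} = J" using insert(2) by auto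
    then show "L2_norm (\<lambda>t. e k t - (\<Sum>j\<in>J. c j * e j t)) > 0"
      using insert.prems(2)[of k c] by simp
  qed (use insert.prems in auto)
qed

text \<open>Write the dual vector as a combination of the family. Pairing it with itself shows that
  its coefficient at \<open>e j\<close> is its squared norm. Divided by that coefficient it becomes
  \<open>e j\<close> minus a combination of the other vectors, whose norm is the reciprocal of the
  norm of \<open>h j\<close> and at least \<delta>.\<close>

lemma dual_family_norm_le:
  assumes J: "finite J" and d: "dual_family J e h" and j: "j \<in> J" and "\<delta> > 0"
    and dist: "\<And>c. L2_norm (\<lambda>t. e j t - (\<Sum>i\<in>J - {j}. c i * e i t)) \<ge> \<delta>"
  shows "L2_norm (h j) \<le> 1 / \<delta>"
proof -
  have e: "in_L2 (e i)" if "i \<in> J" for i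
    using dual_family_in_L2[OF d that] by simp
  obtain c where c: "h j = (\<lambda>t. \<Sum>i\<in>J. c i * e i t)"
    using d j unfolding dual_family_def by blast
  have hj: "in_L2 (h j)" using dual_family_in_L2[OF d j] by simp
  have "L2_inner (h j) (h j) = (\<Sum>i\<in>J. c i * L2_inner (e i) (h j))"
    by (subst c) (simp add: L2_inner_sum_left e hj)
  also have "\<dots> = (\<Sum>i\<in>J. if i = j then c i else 0)"
    using d j by (intro sum.cong) (auto simp: dual_family_def)
  finally have cj: "c j = of_real ((L2_norm (h j))\<^sup>2)"
    using J j by (simp add: L2_inner_self)
  show ?thesis
  proof (cases "L2_norm (h j) = 0")
    case False
    then have "L2_norm (h j) > 0" using L2_norm_nonneg[of "h j"] by simp
    have nz: "c j \<noteq> 0" using False by (simp add: cj)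
    have "e j t - (\<Sum>i\<in>J - {j}. (- c i / c j) * e i t) = inverse (c j) * h j t" for t
    proof -
      have "h j t = c j * e j t + (\<Sum>i\<in>J - {j}. c i * e i t)"
        using J j by (simp add: c sum.remove)
      then show ?thesis
        using nz by (simp add: field_simps sum_negf sum_divide_distrib[symmetric] sum_distrib_left)
    qed
    then have "\<delta> \<le> cmod (inverse (c j)) * L2_norm (h j)"
      using dist[of "\<lambda>i. - c i / c j"] by (simp only: L2_norm_scale)
    also have "\<dots> = 1 / L2_norm (h j)"
      unfolding cj norm_inverse norm_of_real using False by (simp add: power2_eq_square divide_simps)
    finally show ?thesis
      using \<open>\<delta> > 0\<close> \<open>L2_norm (h j) > 0\<close> by (simp add: field_simps)
  qed (use \<open>\<delta> > 0\<close> in simp)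
qed

text \<open>Best approximation: the projection P fixes every combination w of the \<phi>, so f and g
  = f - w have the same residual, and the residual of g is no longer than g.\<close>

lemma L2_norm_orthonormal_residual:
  assumes K: "finite K" "\<And>k. k \<in> K \<Longrightarrow> in_L2 (\<phi> k)"
    and on: "\<And>i k. i \<in> K \<Longrightarrow> k \<in> K \<Longrightarrow> L2_inner (\<phi> i) (\<phi> k) = (if i = k then 1 else 0)"
    and f: "in_L2 f"
  shows "L2_norm (\<lambda>t. f t - oblique_proj K \<phi> \<phi> f t) \<le> L2_norm (\<lambda>t. f t - (\<Sum>k\<in>K. c k * \<phi> k t))"
proof -
  let ?w = "\<lambda>t. \<Sum>k\<in>K. c k * \<phi> k t" and ?P = "oblique_proj K \<phi> \<phi>"
  let ?g = "\<lambda>t. f t - ?w t"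
  have d: "dual_family K \<phi> \<phi>"
    using K on by (rule dual_family_orthonormal)
  have w: "in_L2 ?w" using K by (intro in_L2_sum in_L2_scale)
  have g: "in_L2 ?g" using f w by (rule in_L2_diff)
  have "L2_inner ?g (\<phi> k) = L2_inner f (\<phi> k) - c k" if "k \<in> K" for k
    using K on f w that by (simp add: L2_inner_diff_left) (simp add: L2_inner_sum_left if_distrib[of "\<lambda>x. _ * x"] cong: if_cong)
  then have "?P ?g t = (\<Sum>k\<in>K. (L2_inner f (\<phi> k) - c k) * \<phi> k t)" for t
    unfolding oblique_proj_def by (intro sum.cong) auto
  then have "?P ?g t = ?P f t - ?w t" for t
    by (simp add: oblique_proj_def left_diff_distrib sum_subtractf)
  then have eq: "(\<lambda>t. f t - ?P f t) = (\<lambda>t. ?g t - ?P ?g t)"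
    by simp
  have "L2_inner (?P ?g) ?g = (\<Sum>k\<in>K. of_real ((cmod (L2_inner ?g (\<phi> k)))\<^sup>2))"
    using K g unfolding oblique_proj_def
    by (subst L2_inner_sum_left) (auto simp: complex_norm_square L2_inner_commute[of "\<phi> _" ?g] intro!: sum.cong simp del: of_real_power)
  then have "Re (L2_inner (?P ?g) ?g) \<ge> 0"
    by (simp add: sum_nonneg)
  then have "(L2_norm (\<lambda>t. ?g t - ?P ?g t))\<^sup>2 \<le> (L2_norm ?g)\<^sup>2"
    using L2_norm_oblique_proj[OF d g] by simp
  then show ?thesis
    unfolding eq by (rule power2_le_imp_le) (rule L2_norm_nonneg)
qed

text \<open>Compare the trace of the product of the projection onto the span of e with the one onto
  the span of \<phi>, computed once along each family.\<close>

lemma card_le_of_approximate_containment: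
  assumes J: "finite J" "\<And>j. j \<in> J \<Longrightarrow> in_L2 (e j)" and "\<delta> > 0"
    and dist: "\<And>j c. j \<in> J \<Longrightarrow> L2_norm (\<lambda>t. e j t - (\<Sum>i\<in>J - {j}. c i * e i t)) \<ge> \<delta>"
    and K: "finite K" "\<And>k. k \<in> K \<Longrightarrow> in_L2 (\<phi> k)"
    and on: "\<And>i k. i \<in> K \<Longrightarrow> k \<in> K \<Longrightarrow> L2_inner (\<phi> i) (\<phi> k) = (if i = k then 1 else 0)"
    and approx: "\<And>j. j \<in> J \<Longrightarrow> \<exists>c. L2_norm (\<lambda>t. e j t - (\<Sum>k\<in>K. c k * \<phi> k t)) \<le> \<epsilon>"
  shows "real (card J) * (1 - \<epsilon> / \<delta>) \<le> real (card K)"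
proof -
  have "L2_norm (\<lambda>t. e j t - (\<Sum>i\<in>J - {j}. c i * e i t)) > 0" if "j \<in> J" for j c
    using dist[OF that, of c] \<open>\<delta> > 0\<close> by linarith
  from dual_family_exists[OF J this] obtain h where h: "dual_family J e h"
    by blast
  note hL2 = dual_family_in_L2(2)[OF h]
  let ?P = "oblique_proj K \<phi> \<phi>" and ?Q = "oblique_proj J e h"
  have PL2: "in_L2 (?P f)" for f
    using K(2) by (rule in_L2_oblique_proj)
  \<comment> \<open>Both traces are the double sum of <e_j, \<phi>_k> <\<phi>_k, h_j>, summed in the
    two possible orders.\<close>
  have "(\<Sum>j\<in>J. L2_inner (?P (e j)) (h j)) = (\<Sum>j\<in>J. \<Sum>k\<in>K. L2_inner (e j) (\<phi> k) * L2_inner (\<phi> k) (h j))"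
    unfolding oblique_proj_def by (simp add: L2_inner_sum_left K hL2)
  also have "\<dots> = (\<Sum>k\<in>K. \<Sum>j\<in>J. L2_inner (\<phi> k) (h j) * L2_inner (e j) (\<phi> k))"
    by (subst sum.swap) (simp add: mult.commute)
  also have "\<dots> = (\<Sum>k\<in>K. L2_inner (?Q (\<phi> k)) (\<phi> k))"
    unfolding oblique_proj_def by (simp add: L2_inner_sum_left K J)
  finally have trace: "(\<Sum>j\<in>J. L2_inner (?P (e j)) (h j)) = (\<Sum>k\<in>K. L2_inner (?Q (\<phi> k)) (\<phi> k))" .
  have "Re (L2_inner (?Q (\<phi> k)) (\<phi> k)) \<le> 1" if "k \<in> K" for k
  proof -
    have "complex_of_real ((L2_norm (\<phi> k))\<^sup>2) = 1"
      unfolding L2_inner_self[symmetric] using on[OF that that] by simp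
    then have "(L2_norm (\<phi> k))\<^sup>2 = 1"
      by (simp only: of_real_eq_1_iff)
    then show ?thesis
      using Re_L2_inner_oblique_proj_le[OF h K(2)[OF that]] by simp
  qed
  then have upper: "Re (\<Sum>k\<in>K. L2_inner (?Q (\<phi> k)) (\<phi> k)) \<le> real (card K)"
    using sum_mono[of K "\<lambda>k. Re (L2_inner (?Q (\<phi> k)) (\<phi> k))" "\<lambda>_. 1"] by simp
  \<comment> \<open>By biorthogonality this inner product is 1 minus the pairing of the residual
    with \<open>h j\<close>; Cauchy-Schwarz bounds the pairing by \<epsilon> times 1 /
    \<delta>.\<close>
  have "Re (L2_inner (?P (e j)) (h j)) \<ge> 1 - \<epsilon> / \<delta>" if j: "j \<in> J" for j
  proof -
    obtain c where c: "L2_norm (\<lambda>t. e j t - (\<Sum>k\<in>K. c k * \<phi> k t)) \<le> \<epsilon>"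
      using approx[OF j] by blast
    let ?r = "\<lambda>t. e j t - ?P (e j) t"
    have r: "L2_norm ?r \<le> \<epsilon>"
      using L2_norm_orthonormal_residual[OF K on J(2)[OF j], of c] c by linarith
    have "Re (L2_inner ?r (h j)) \<le> L2_norm ?r * L2_norm (h j)"
      using L2_inner_le[of ?r "h j"] complex_Re_le_cmod[of "L2_inner ?r (h j)"] j J PL2 hL2
      by (simp add: in_L2_diff)
    also have "\<dots> \<le> \<epsilon> * (1 / \<delta>)"
      using r dual_family_norm_le[OF J(1) h j \<open>\<delta> > 0\<close> dist[OF j]] order_trans[OF L2_norm_nonneg r]
      by (intro mult_mono) (auto simp: L2_norm_nonneg)
    finally have "Re (L2_inner ?r (h j)) \<le> \<epsilon> / \<delta>" by simp
    moreover have "L2_inner ?r (h j) = 1 - L2_inner (?P (e j)) (h j)"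
      using h j J PL2 hL2 by (subst L2_inner_diff_left) (auto simp: dual_family_def)
    ultimately show ?thesis by simp
  qed
  then have "(\<Sum>j\<in>J. 1 - \<epsilon> / \<delta>) \<le> (\<Sum>j\<in>J. Re (L2_inner (?P (e j)) (h j)))"
    by (rule sum_mono)
  then show ?thesis
    using upper unfolding trace[symmetric] by simp
qed

subsection \<open>An orthonormal Gabor basis\<close>

text \<open>The half-open cell makes the integer translates tile the line without overlap.\<close>

definition gabor_box :: "int \<times> int \<Rightarrow> real \<Rightarrow> complex" where
  "gabor_box k = tf_shift (indicator {0..<1}) (of_int (fst k)) (of_int (snd k))"

lemma gabor_box_eq:
  "gabor_box (m, l) t = cis (2 * pi * l * t) * indicator {real_of_int m..<m + 1} t"
  by (auto simp: gabor_box_def tf_shift_def indicator_def)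

lemma borel_measurable_cis [measurable]: "cis \<in> borel_measurable borel"
  by (intro borel_measurable_continuous_onI continuous_intros)

lemma in_L2_bounded_support:
  assumes "h \<in> borel_measurable borel" "\<And>t. cmod (h t) \<le> C * indicator {a..b} t"
  shows "in_L2 h"
proof (rule L2_norm_mono(1))
  show "in_L2 (\<lambda>t. of_real C * indicator {a..b} t)"
    by (intro in_L2_scale in_L2_indicator_interval)
  show "cmod (h t) \<le> cmod (of_real C * indicator {a..b} t)" for t
    using assms(2)[of t] by (auto simp: norm_mult indicator_def)
qed (use assms in simp)

lemma in_L2_gabor_box: "in_L2 (gabor_box k)"
proof (cases k)
  case (Pair m l)
  show ?thesis
    unfolding Pair
  proof (rule in_L2_bounded_support[where C = 1])
    show "gabor_box (m, l) \<in> borel_measurable borel"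
      unfolding gabor_box_eq[abs_def] by measurable
    show "cmod (gabor_box (m, l) t) \<le> 1 * indicator {real_of_int m..m + 1} t" for t
      by (auto simp: gabor_box_eq indicator_def norm_mult)
  qed
qed

lemma integral_cis_period:
  fixes m j :: int
  assumes "j \<noteq> 0"
  shows "(LINT t|lborel. indicator {real_of_int m..m + 1} t *\<^sub>R cis (2 * pi * j * t)) = 0"
proof -
  define F where "F t = cis (2 * pi * j * t) / (2 * pi * j * \<i>)" for t :: real
  have "(LINT t|lborel. indicator {real_of_int m..m + 1} t *\<^sub>R cis (2 * pi * j * t)) = F (m + 1) - F m"
  proof (rule integral_FTC_Icc)
    show "(F has_vector_derivative cis (2 * pi * j * t)) (at t within {real_of_int m..m + 1})" for t
      unfolding has_vector_derivative_def F_def[abs_def] using assms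
      by (auto intro!: derivative_eq_intros simp: fun_eq_iff scaleR_conv_of_real mult_ac)
    show "continuous_on {real_of_int m..m + 1} (\<lambda>t. cis (2 * pi * j * t))"
      by (intro continuous_intros)
  qed simp
  also have "F (m + 1) = F m"
  proof -
    have "cis (2 * pi * j * (m + 1)) = cis (2 * pi * j * m) * cis (2 * pi * j)"
      by (simp add: cis_mult algebra_simps)
    then show ?thesis by (simp add: F_def)
  qed
  finally show ?thesis by simp
qed

lemma gabor_box_orthonormal: "L2_inner (gabor_box i) (gabor_box k) = (if i = k then 1 else 0)"
proof (cases i; cases k)
  fix m l m' l' assume eq: "i = (m, l)" "k = (m', l')"
  show ?thesis
  proof (cases "m = m'")
    case False
    have "m' = m" if "real_of_int m \<le> t" "t < real_of_int m + 1"
      "real_of_int m' \<le> t" "t < real_of_int m' + 1" for t :: real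
      using that by linarith
    then have zero: "gabor_box i t * cnj (gabor_box k t) = 0" for t
      using False by (auto simp: eq gabor_box_eq indicator_def)
    show ?thesis
      unfolding L2_inner_def zero using False eq by simp
  next
    case m: True
    have "L2_inner (gabor_box i) (gabor_box k) =
        (LINT t|lborel. indicator {real_of_int m..m + 1} t *\<^sub>R cis (2 * pi * (l - l') * t))"
      unfolding L2_inner_def
    proof (rule integral_cong_AE)
      show "AE t in lborel. gabor_box i t * cnj (gabor_box k t) =
          indicator {real_of_int m..m + 1} t *\<^sub>R cis (2 * pi * (l - l') * t)"
        \<comment> \<open>The cell is closed up at its right endpoint, a null set, so that the
          integral over a full period can be evaluated by the fundamental theorem.\<close>
        using AE_lborel_singleton[of "real_of_int m + 1"]
      proof eventually_elim
        case (elim t)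
        have "cis (2 * pi * l * t) * cnj (cis (2 * pi * l' * t)) = cis (2 * pi * (l - l') * t)"
          by (simp add: cis_cnj cis_mult algebra_simps)
        then show ?case
          using elim m by (auto simp: eq gabor_box_eq indicator_def)
      qed
      show "(\<lambda>t. gabor_box i t * cnj (gabor_box k t)) \<in> borel_measurable lborel"
        by (intro borel_measurable_integrable integrable_L2_inner in_L2_gabor_box)
    qed measurable
    also have "\<dots> = (if i = k then 1 else 0)"
    proof (cases "l = l'")
      case True
      have "(LINT t|lborel. indicator {real_of_int m..m + 1} t *\<^sub>R (1::complex)) = 1"
        by (simp add: emeasure_lborel_Icc_eq)
      then show ?thesis using True m eq by simp
    next
      case False
      then show ?thesis
        using integral_cis_period[of "l - l'" m] eq by simp
    qed
    finally show ?thesis .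
  qed
qed

section \<open>Completeness: the closed linear span of the shifted boxes\<close>

definition gabor_limit :: "(real \<Rightarrow> complex) \<Rightarrow> bool" where
  "gabor_limit f \<longleftrightarrow> in_L2 f \<and>
    (\<forall>\<epsilon>>0. \<exists>F c. finite F \<and> L2_norm (\<lambda>t. f t - (\<Sum>k\<in>F. c k * gabor_box k t)) < \<epsilon>)"

lemma in_L2_gabor_sum: "in_L2 (\<lambda>t. \<Sum>k\<in>F. c k * gabor_box k t)"
  by (intro in_L2_sum in_L2_scale in_L2_gabor_box)

lemma gabor_limit_box: "gabor_limit (gabor_box k)"
proof -
  have "L2_norm (\<lambda>t. gabor_box k t - (\<Sum>i\<in>{k}. 1 * gabor_box i t)) = 0"
    by (simp add: L2_norm_def)
  then have "\<exists>F c. finite F \<and> L2_norm (\<lambda>t. gabor_box k t - (\<Sum>i\<in>F. c i * gabor_box i t)) < \<epsilon>"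
    if "\<epsilon> > 0" for \<epsilon>
    using that by (intro exI[of _ "{k}"] exI[of _ "\<lambda>_. 1"]) simp
  then show ?thesis
    unfolding gabor_limit_def using in_L2_gabor_box by blast
qed

lemma gabor_limit_add:
  assumes "gabor_limit f" "gabor_limit g"
  shows "gabor_limit (\<lambda>t. f t + g t)"
  unfolding gabor_limit_def
proof (intro conjI allI impI)
  have L2: "in_L2 f" "in_L2 g"
    using assms by (auto simp: gabor_limit_def)
  then show "in_L2 (\<lambda>t. f t + g t)" by (rule in_L2_add)
  fix \<epsilon> :: real assume "\<epsilon> > 0"
  then obtain F c G d where F: "finite F" "L2_norm (\<lambda>t. f t - (\<Sum>k\<in>F. c k * gabor_box k t)) < \<epsilon> / 2"
      and G: "finite G" "L2_norm (\<lambda>t. g t - (\<Sum>k\<in>G. d k * gabor_box k t)) < \<epsilon> / 2"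
    using assms unfolding gabor_limit_def by (meson half_gt_zero)
  \<comment> \<open>Extended by zero, both coefficient families live on one index set.\<close>
  define c' where "c' k = (if k \<in> F then c k else 0)" for k
  define d' where "d' k = (if k \<in> G then d k else 0)" for k
  have cF: "(\<Sum>k\<in>F. c k * gabor_box k t) = (\<Sum>k\<in>F \<union> G. c' k * gabor_box k t)" for t
    using F(1) G(1) by (intro sum.mono_neutral_cong_left) (auto simp: c'_def)
  have dG: "(\<Sum>k\<in>G. d k * gabor_box k t) = (\<Sum>k\<in>F \<union> G. d' k * gabor_box k t)" for t
    using F(1) G(1) by (intro sum.mono_neutral_cong_left) (auto simp: d'_def)
  have "(\<lambda>t. f t + g t - (\<Sum>k\<in>F \<union> G. (c' k + d' k) * gabor_box k t)) =
      (\<lambda>t. (f t - (\<Sum>k\<in>F. c k * gabor_box k t)) + (g t - (\<Sum>k\<in>G. d k * gabor_box k t)))"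
    unfolding cF dG by (simp add: distrib_right sum.distrib fun_eq_iff)
  moreover have "L2_norm \<dots> \<le> L2_norm (\<lambda>t. f t - (\<Sum>k\<in>F. c k * gabor_box k t)) +
      L2_norm (\<lambda>t. g t - (\<Sum>k\<in>G. d k * gabor_box k t))"
    by (intro L2_norm_triangle in_L2_diff L2 in_L2_gabor_sum)
  ultimately have "L2_norm (\<lambda>t. f t + g t - (\<Sum>k\<in>F \<union> G. (c' k + d' k) * gabor_box k t)) < \<epsilon>"
    using F(2) G(2) by simp
  then show "\<exists>F c. finite F \<and> L2_norm (\<lambda>t. f t + g t - (\<Sum>k\<in>F. c k * gabor_box k t)) < \<epsilon>"
    using F(1) G(1) by (intro exI[of _ "F \<union> G"] exI[of _ "\<lambda>k. c' k + d' k"]) simp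
qed

lemma gabor_limit_scale:
  assumes "gabor_limit f"
  shows "gabor_limit (\<lambda>t. a * f t)"
  unfolding gabor_limit_def
proof (intro conjI allI impI)
  show "in_L2 (\<lambda>t. a * f t)"
    using assms by (simp add: gabor_limit_def in_L2_scale)
  fix \<epsilon> :: real assume "\<epsilon> > 0"
  \<comment> \<open>The summand 1 covers the case a = 0.\<close>
  then have "\<epsilon> / (cmod a + 1) > 0"
    by (simp add: add_nonneg_pos)
  then obtain F c where F: "finite F"
      "L2_norm (\<lambda>t. f t - (\<Sum>k\<in>F. c k * gabor_box k t)) < \<epsilon> / (cmod a + 1)" (is "L2_norm ?r < _")
    using assms unfolding gabor_limit_def by meson
  have "L2_norm (\<lambda>t. a * f t - (\<Sum>k\<in>F. (a * c k) * gabor_box k t)) = cmod a * L2_norm ?r"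
    unfolding L2_norm_scale[symmetric] by (simp add: right_diff_distrib sum_distrib_left mult.assoc)
  also have "\<dots> \<le> (cmod a + 1) * L2_norm ?r"
    by (simp add: L2_norm_nonneg distrib_right)
  also have "\<dots> < \<epsilon>"
    using F(2) by (simp add: pos_less_divide_eq add_nonneg_pos mult.commute)
  finally show "\<exists>F c. finite F \<and> L2_norm (\<lambda>t. a * f t - (\<Sum>k\<in>F. c k * gabor_box k t)) < \<epsilon>"
    using F(1) by (intro exI[of _ F] exI[of _ "\<lambda>k. a * c k"]) simp
qed

lemma gabor_limit_zero: "gabor_limit (\<lambda>t. 0)"
  using gabor_limit_scale[OF gabor_limit_box, of 0] by simp

lemma gabor_limit_sum:
  "(\<And>i. i \<in> I \<Longrightarrow> gabor_limit (f i)) \<Longrightarrow> gabor_limit (\<lambda>t. \<Sum>i\<in>I. f i t)"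
  by (induction I rule: infinite_finite_induct) (auto intro: gabor_limit_zero gabor_limit_add)

lemma gabor_limit_lim:
  assumes f: "in_L2 f" and s: "\<And>n::nat. gabor_limit (s n)"
    and lim: "(\<lambda>n. L2_norm (\<lambda>t. s n t - f t)) \<longlonglongrightarrow> 0"
  shows "gabor_limit f"
  unfolding gabor_limit_def
proof (intro conjI allI impI f)
  fix \<epsilon> :: real assume "\<epsilon> > 0"
  then have "\<forall>\<^sub>F n in sequentially. L2_norm (\<lambda>t. s n t - f t) < \<epsilon> / 2"
    by (intro order_tendstoD(2)[OF lim]) simp
  then obtain n where n: "L2_norm (\<lambda>t. s n t - f t) < \<epsilon> / 2"
    by (meson eventually_happens' sequentially_bot)
  obtain F c where F: "finite F" "L2_norm (\<lambda>t. s n t - (\<Sum>k\<in>F. c k * gabor_box k t)) < \<epsilon> / 2"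
    using s[of n] \<open>\<epsilon> > 0\<close> unfolding gabor_limit_def by (meson half_gt_zero)
  have "L2_norm (\<lambda>t. f t - (\<Sum>k\<in>F. c k * gabor_box k t)) \<le>
      L2_norm (\<lambda>t. f t - s n t) + L2_norm (\<lambda>t. s n t - (\<Sum>k\<in>F. c k * gabor_box k t))"
    using f s[of n] in_L2_gabor_sum by (intro L2_norm_diff_triangle) (auto simp: gabor_limit_def)
  then have "L2_norm (\<lambda>t. f t - (\<Sum>k\<in>F. c k * gabor_box k t)) < \<epsilon>"
    using n F(2) by (simp add: L2_norm_minus_commute[of f])
  then show "\<exists>F c. finite F \<and> L2_norm (\<lambda>t. f t - (\<Sum>k\<in>F. c k * gabor_box k t)) < \<epsilon>"
    using F(1) by blast
qed

section \<open>Trigonometric polynomials and continuous functions on the circle\<close>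

inductive trig_polynomial :: "(real \<Rightarrow> complex) \<Rightarrow> bool" where
  exp: "trig_polynomial (\<lambda>t. cis (of_int k * t))"
| add: "trig_polynomial f \<Longrightarrow> trig_polynomial g \<Longrightarrow> trig_polynomial (\<lambda>t. f t + g t)"
| scale: "trig_polynomial f \<Longrightarrow> trig_polynomial (\<lambda>t. c * f t)"

text \<open>Induction on both factors reduces the product to that of two exponentials, whose
  frequencies add.\<close>

lemma trig_polynomial_mult:
  assumes "trig_polynomial f" "trig_polynomial g"
  shows "trig_polynomial (\<lambda>t. f t * g t)"
  using assms(1)
proof induction
  case (exp k)
  show ?case
    using assms(2)
  proof induction
    case (exp l)
    then show ?case
      using trig_polynomial.exp[of "k + l"] by (simp add: cis_mult distrib_right)
  next
    case (add f g)
    then show ?case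
      by (simp add: distrib_left trig_polynomial.add)
  next
    case (scale f c)
    then show ?case
      using trig_polynomial.scale[of "\<lambda>t. cis (of_int k * t) * f t" c] by (simp add: mult_ac)
  qed
next
  case (add f1 f2)
  then show ?case
    by (simp add: distrib_right trig_polynomial.add)
next
  case (scale f c)
  then show ?case
    using trig_polynomial.scale[of "\<lambda>t. f t * g t" c] by (simp add: mult_ac)
qed

text \<open>Connects Stone-Weierstrass on the circle, which produces real polynomials in the
  coordinates, with the exponentials in the boxes.\<close>

lemma trig_polynomial_on_circle:
  fixes p :: "complex \<Rightarrow> real"
  assumes "real_polynomial_function p"
  shows "trig_polynomial (\<lambda>t. of_real (p (cis t)))"
  using assms
proof induction
  case (linear f)
  interpret bounded_linear f by fact
  define a b where "a = complex_of_real (f 1)" and "b = complex_of_real (f \<i>)"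
  \<comment> \<open>A real-linear functional takes the value f(1) cos t + f(i) sin t at
    \<open>cis t\<close>; Euler's formulas give the coefficients.\<close>
  have "of_real (f (cis t)) = (a - \<i> * b) / 2 * cis (of_int 1 * t) + (a + \<i> * b) / 2 * cis (of_int (-1) * t)" for t
  proof -
    have "cis t = cos t *\<^sub>R 1 + sin t *\<^sub>R \<i>"
      by (simp add: complex_eq_iff)
    then have "f (cis t) = cos t * f 1 + sin t * f \<i>"
      by (simp only: add scaleR real_scaleR_def)
    then show ?thesis
      by (simp add: a_def b_def complex_eq_iff) (simp add: field_simps)
  qed
  then show ?case
    by (simp only:) (intro trig_polynomial.intros)
next
  case (const c)
  show ?case
    using trig_polynomial.scale[OF trig_polynomial.exp[of 0], of "of_real c"] by simp
next
  case (add f g)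
  then show ?case by (simp add: trig_polynomial.add)
next
  case (mult f g)
  then show ?case by (simp add: trig_polynomial_mult)
qed

lemma gabor_limit_trig_polynomial:
  fixes m :: int
  assumes "trig_polynomial h"
  shows "gabor_limit (\<lambda>t. h (2 * pi * t) * indicator {real_of_int m..<m + 1} t)"
  using assms
proof induction
  case (exp k)
  then show ?case
    using gabor_limit_box[of "(m, k)"] by (simp add: gabor_box_eq[abs_def] mult_ac)
next
  case (add f g)
  then show ?case
    using gabor_limit_add[OF add.IH] by (simp add: distrib_right)
next
  case (scale f c)
  then show ?case
    using gabor_limit_scale[OF scale.IH, of c] by (simp add: mult.assoc)
qed

text \<open>A function on the circle has matching values at the ends of a unit cell, so
  trigonometric polynomials approximate it uniformly. On a cell of finite length uniform convergence
  implies convergence in L^2.\<close>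

lemma gabor_limit_continuous_on_circle:
  fixes m :: int and F :: "complex \<Rightarrow> real"
  assumes F: "continuous_on (sphere 0 1) F"
  shows "gabor_limit (\<lambda>t. of_real (F (cis (2 * pi * t))) * indicator {real_of_int m..<m + 1} t)"
    (is "gabor_limit ?f")
proof -
  have ex: "\<exists>p. real_polynomial_function p \<and> (\<forall>z\<in>sphere 0 1. \<bar>F z - p z\<bar> < inverse (real (Suc n)))" for n
    by (rule Stone_Weierstrass_real_polynomial_function[OF compact_sphere F, of "inverse (real (Suc n))"])
      (auto simp del: of_nat_Suc)
  from choice[OF allI[OF ex]] obtain p where "\<forall>n. real_polynomial_function (p n) \<and>
      (\<forall>z\<in>sphere 0 1. \<bar>F z - p n z\<bar> < inverse (real (Suc n)))" ..
  then have p: "\<And>n. real_polynomial_function (p n)"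
      "\<And>n z. cmod z = 1 \<Longrightarrow> \<bar>F z - p n z\<bar> < inverse (real (Suc n))"
    by (simp_all del: of_nat_Suc)
  let ?s = "\<lambda>n t. of_real (p n (cis (2 * pi * t))) * indicator {real_of_int m..<m + 1} t :: complex"
  have cont: "continuous_on UNIV (\<lambda>t. F (cis (2 * pi * t)))"
    by (rule continuous_on_compose2[OF F]) (auto intro!: continuous_intros)
  have meas: "?f \<in> borel_measurable borel"
    using borel_measurable_continuous_onI[OF cont] by measurable
  have s: "gabor_limit (?s n)" for n
    using gabor_limit_trig_polynomial[OF trig_polynomial_on_circle[OF p(1)]] .
  obtain C where "\<forall>z\<in>sphere 0 1. \<bar>F z\<bar> \<le> C"
    using compact_imp_bounded[OF compact_continuous_image[OF F compact_sphere]]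
    by (auto simp: bounded_iff)
  then have C: "\<And>z. cmod z = 1 \<Longrightarrow> \<bar>F z\<bar> \<le> C"
    by simp
  have f: "in_L2 ?f"
    by (rule in_L2_bounded_support[OF meas, of C m "m + 1"])
      (use C order_trans[OF abs_ge_zero C[of 1]] in \<open>auto simp: indicator_def norm_mult\<close>)
  show ?thesis
  proof (rule gabor_limit_lim[OF f s])
    have close: "cmod (?s n t - ?f t) \<le> inverse (real (Suc n)) * indicator {real_of_int m..m + 1} t" for n t
    proof -
      have "cmod (?s n t - ?f t) = \<bar>F (cis (2 * pi * t)) - p n (cis (2 * pi * t))\<bar> * indicator {real_of_int m..<m + 1} t"
        by (auto simp: indicator_def norm_minus_commute simp flip: of_real_diff)
      then show ?thesis
        using p(2)[of "cis (2 * pi * t)" n] by (auto simp: indicator_def)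
    qed
    show "(\<lambda>n. L2_norm (\<lambda>t. ?s n t - ?f t)) \<longlonglongrightarrow> 0"
    proof (rule L2_dominated_convergence[where w = "indicator {real_of_int m..m + 1}"])
      show "?s n \<in> borel_measurable lborel" for n
        using s[of n] by (simp add: gabor_limit_def in_L2_def)
      have "(\<lambda>n. ?s n t - ?f t) \<longlonglongrightarrow> 0" for t
      proof (rule Lim_null_comparison)
        show "\<forall>\<^sub>F n in sequentially. cmod (?s n t - ?f t) \<le> inverse (real (Suc n)) * indicator {real_of_int m..m + 1} t"
          using close by simp
        show "(\<lambda>n. inverse (real (Suc n)) * indicator {real_of_int m..m + 1} t) \<longlonglongrightarrow> 0"
          using tendsto_mult_left_zero[OF LIMSEQ_inverse_real_of_nat] .
      qed
      then show "AE t in lborel. (\<lambda>n. ?s n t) \<longlonglongrightarrow> ?f t"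
        by (intro AE_I2) (simp only: LIM_zero_iff)
      show "(cmod (?s n t - ?f t))\<^sup>2 \<le> indicator {real_of_int m..m + 1} t" for n t
      proof -
        have "inverse (real (Suc n)) \<le> 1" by (simp add: field_simps)
        then have "cmod (?s n t - ?f t) \<le> indicator {real_of_int m..m + 1} t"
          using order_trans[OF close[of n t], of "indicator {real_of_int m..m + 1} t"]
          by (auto simp: indicator_def split: if_splits)
        then have "(cmod (?s n t - ?f t))\<^sup>2 \<le> (indicator {real_of_int m..m + 1} t)\<^sup>2"
          by (rule power_mono) simp
        also have "\<dots> = indicator {real_of_int m..m + 1} t"
          by (simp add: indicator_def)
        finally show ?thesis .
      qed
    qed (use meas in \<open>simp_all add: emeasure_lborel_Icc_eq\<close>)
  qed
qed

lemma cis_2pi_inj: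
  assumes "cis (2 * pi * s) = cis (2 * pi * t)" "\<bar>s - t\<bar> < 1"
  shows "s = t"
proof -
  have "cis (2 * pi * (s - t)) = 1"
    using assms(1) by (simp add: right_diff_distrib cis_divide[symmetric])
  then have "cos (2 * pi * (s - t)) = 1"
    by (simp add: complex_eq_iff)
  then obtain n :: int where "2 * pi * (s - t) = n * 2 * pi"
    by (auto simp: cos_one_2pi_int)
  then have n: "s - t = n" by simp
  then have "n = 0" using assms(2) by linarith
  then show ?thesis using n by simp
qed

text \<open>The tents 1 - n dist(z, K) on the unit circle decrease to the indicator of the arc K.\<close>

lemma gabor_limit_interval_piece:
  fixes m :: int
  shows "gabor_limit (indicator ({c..d} \<inter> {real_of_int m..<m + 1}))"
\<comment> \<open>By convention \<open>infdist\<close> to the empty set is 0, so the tents would not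
  vanish; this case is treated apart.\<close>
proof (cases "{c..d} \<inter> {real_of_int m..m + 1} = {}")
  case True
  then have "indicator ({c..d} \<inter> {real_of_int m..<m + 1}) = (\<lambda>t. 0 :: complex)"
    by (auto simp: indicator_def fun_eq_iff)
  then show ?thesis using gabor_limit_zero by simp
next
  case False
  define A where "A = {c..d} \<inter> {real_of_int m..m + 1}"
  define K where "K = (\<lambda>t. cis (2 * pi * t)) ` A"
  have "compact K"
    unfolding K_def A_def by (intro compact_continuous_image continuous_intros) auto
  then have K: "closed K" "K \<noteq> {}"
    using False by (auto simp: K_def A_def compact_imp_closed)
  let ?F = "\<lambda>n z. max 0 (1 - real n * infdist z K)"
  let ?s = "\<lambda>n t. of_real (?F n (cis (2 * pi * t))) * indicator {real_of_int m..<m + 1} t :: complex"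
  let ?f = "indicator ({c..d} \<inter> {real_of_int m..<m + 1}) :: real \<Rightarrow> complex"
  have s: "gabor_limit (?s n)" for n
    by (intro gabor_limit_continuous_on_circle continuous_intros)
  show ?thesis
  proof (rule gabor_limit_lim[OF _ s])
    show "in_L2 ?f"
      by (rule L2_norm_mono[OF _ in_L2_indicator_interval[of c d]]) (auto simp: indicator_def)
    show "(\<lambda>n. L2_norm (\<lambda>t. ?s n t - ?f t)) \<longlonglongrightarrow> 0"
    proof (rule L2_dominated_convergence[where w = "indicator {real_of_int m..m + 1}"])
      show "?s n \<in> borel_measurable lborel" for n
        using s[of n] by (simp add: gabor_limit_def in_L2_def)
      show "AE t in lborel. (\<lambda>n. ?s n t) \<longlonglongrightarrow> ?f t"
        \<comment> \<open>The points m and m + 1 have the same image on the circle. If A contains m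
          + 1 but not m, the tents have the wrong limit at m, so that point is discarded.\<close>
        using AE_lborel_singleton[of "real_of_int m"]
      proof eventually_elim
        case (elim t)
        show ?case
        proof (cases "t \<in> {real_of_int m..<m + 1}")
          case t: True
          show ?thesis
          proof (cases "t \<in> A")
            case True
            then have "infdist (cis (2 * pi * t)) K = 0"
              by (simp add: K_def)
            then show ?thesis using True t by (simp add: A_def)
          next
            case False
            have "cis (2 * pi * t) \<notin> K"
            proof
              assume "cis (2 * pi * t) \<in> K"
              then obtain u where "u \<in> A" "cis (2 * pi * t) = cis (2 * pi * u)"
                by (auto simp: K_def)
              then show False
                using cis_2pi_inj[of t u] t elim False by (auto simp: A_def)
            qed
            then have pos: "infdist (cis (2 * pi * t)) K > 0"
              using K by (simp add: infdist_pos_not_in_closed)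
            then obtain N :: nat where N: "1 < real N * infdist (cis (2 * pi * t)) K"
              using reals_Archimedean3 by blast
            have "?s n t = ?f t" if "n \<ge> N" for n
            proof -
              have "real N * infdist (cis (2 * pi * t)) K \<le> real n * infdist (cis (2 * pi * t)) K"
                using that pos by (intro mult_right_mono) auto
              then show ?thesis
                using N False t by (auto simp: A_def indicator_def)
            qed
            then show ?thesis
              by (intro tendsto_eventually) (auto simp: eventually_sequentially)
          qed
        qed simp
      qed
      show "(cmod (?s n t - ?f t))\<^sup>2 \<le> indicator {real_of_int m..m + 1} t" for n t
      proof -
        have "0 \<le> ?F n z \<and> ?F n z \<le> 1" for z
          by (simp add: infdist_nonneg)
        moreover have "0 \<le> x \<and> x \<le> 1 \<Longrightarrow> \<bar>x - 1\<bar> \<le> 1 \<and> \<bar>x\<bar> \<le> 1" for x :: real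
          by auto
        ultimately have "\<bar>?F n z - 1\<bar> \<le> 1 \<and> \<bar>?F n z\<bar> \<le> 1" for z
          by blast
        moreover have "?s n t - ?f t = of_real (?F n (cis (2 * pi * t)) - indicator {c..d} t) * indicator {real_of_int m..<m + 1} t"
          by (simp add: indicator_def)
        ultimately have "cmod (?s n t - ?f t) \<le> indicator {real_of_int m..m + 1} t"
          unfolding norm_mult by (auto simp: indicator_def simp del: of_real_diff)
        then have "(cmod (?s n t - ?f t))\<^sup>2 \<le> (indicator {real_of_int m..m + 1} t)\<^sup>2"
          by (rule power_mono) simp
        also have "\<dots> = indicator {real_of_int m..m + 1} t"
          by (simp add: indicator_def)
        finally show ?thesis .
      qed
    qed (simp_all add: emeasure_lborel_Icc_eq)
  qed
qed

lemma gabor_limit_interval: "gabor_limit (indicator {c..d})"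
proof -
  obtain M :: int where M: "\<bar>c\<bar> \<le> M" "\<bar>d\<bar> \<le> M"
    by (meson ex_le_of_int max.bounded_iff max.cobounded1 max.cobounded2 order_trans)
  \<comment> \<open>The choice of M puts the floor of every point of the interval in the range of
    summation, and only that cell contributes.\<close>
  have "(\<Sum>m\<in>{-M..M}. indicator ({c..d} \<inter> {real_of_int m..<m + 1}) t) = (indicator {c..d} t :: complex)" for t
  proof (cases "t \<in> {c..d}")
    case True
    have m: "t \<in> {real_of_int m..<m + 1} \<longleftrightarrow> m = \<lfloor>t\<rfloor>" for m
      by (auto simp: floor_eq_iff eq_commute[of m])
    have "(indicator ({c..d} \<inter> {real_of_int m..<m + 1}) t :: complex) = (if m = \<lfloor>t\<rfloor> then 1 else 0)" for m
      using True m[of m] by (auto simp: indicator_def)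
    moreover have "\<lfloor>t\<rfloor> \<in> {-M..M}"
      using True M by (auto simp: le_floor_iff floor_le_iff)
    ultimately show ?thesis
      using True by simp
  qed (auto intro: sum.neutral)
  then show ?thesis
    using gabor_limit_sum[of "{-M..M}" "\<lambda>m. indicator ({c..d} \<inter> {real_of_int m..<m + 1})",
        OF gabor_limit_interval_piece] by simp
qed

lemma gabor_limit_L2:
  assumes "in_L2 f"
  shows "gabor_limit f"
  using assms
proof (induction rule: L2_induct)
  case (interval c d)
  show ?case by (rule gabor_limit_interval)
next
  case (add f g)
  show ?case by (rule gabor_limit_add[OF add(3,4)])
next
  case (scale c f)
  show ?case by (rule gabor_limit_scale[OF scale(2)])
next
  case (lim f s)
  show ?case by (rule gabor_limit_lim[OF lim(1,4,3)])
qed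

subsection \<open>Uniform approximation of time-frequency shifts\<close>

lemma in_L2_tf_shift:
  assumes "in_L2 f"
  shows "in_L2 (tf_shift f a b)"
  unfolding in_L2_def
proof
  show "tf_shift f a b \<in> borel_measurable lborel"
    unfolding tf_shift_def using in_L2_borel[OF assms] by measurable
  have "integrable lborel (\<lambda>t. (cmod (f (- a + 1 * t)))\<^sup>2)"
    by (rule lborel_integrable_real_affine[OF in_L2_square_integrable[OF assms]]) simp
  then show "integrable lborel (\<lambda>t. (cmod (tf_shift f a b t))\<^sup>2)"
    by (simp add: tf_shift_def norm_mult)
qed

lemma L2_norm_tf_shift: "L2_norm (tf_shift f a b) = L2_norm f"
  unfolding L2_norm_def tf_shift_def
  using lborel_integral_real_affine[of 1 "\<lambda>t. (cmod (f t))\<^sup>2" "- a"] by (simp add: norm_mult)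

lemma tf_shift_add: "tf_shift (\<lambda>t. f t + g t) a b t = tf_shift f a b t + tf_shift g a b t"
  by (simp add: tf_shift_def distrib_left)

lemma L2_norm_tf_shift_diff:
  "L2_norm (\<lambda>t. tf_shift f a b t - tf_shift g a b t) = L2_norm (\<lambda>t. f t - g t)"
  using L2_norm_tf_shift[of "\<lambda>t. f t - g t" a b] by (simp add: tf_shift_def right_diff_distrib)

lemma tf_shift_interval_tendsto:
  fixes X Y :: "nat \<Rightarrow> real"
  assumes X: "X \<longlonglongrightarrow> a" and Y: "Y \<longlonglongrightarrow> b"
  shows "(\<lambda>n. L2_norm (\<lambda>t. tf_shift (indicator {c..d}) (X n) (Y n) t - tf_shift (indicator {c..d}) a b t))
    \<longlonglongrightarrow> 0"
proof -
  \<comment> \<open>A convergent sequence of translations is bounded, so all shifted intervals lie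
    in one bounded interval, which supplies the majorant.\<close>
  obtain B where "B > 0" and XB: "\<And>n. \<bar>X n\<bar> \<le> B"
    using convergent_imp_Bseq[of X] X by (auto simp: convergent_def Bseq_def)
  have aB: "\<bar>a\<bar> \<le> B"
    using LIMSEQ_le_const2[OF tendsto_rabs[OF X]] XB by blast
  have bound: "cmod (tf_shift (indicator {c..d}) x y t) \<le> indicator {c - B..d + B} t" if "\<bar>x\<bar> \<le> B" for x y t
    using that by (auto simp: tf_shift_def norm_mult indicator_def)
  show ?thesis
  proof (rule L2_dominated_convergence[where w = "\<lambda>t. 4 * indicator {c - B..d + B} t"])
    show "AE t in lborel. (\<lambda>n. tf_shift (indicator {c..d}) (X n) (Y n) t) \<longlonglongrightarrow> tf_shift (indicator {c..d}) a b t"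
      \<comment> \<open>Away from the two jumps of the limit the translated indicators are
        eventually constant.\<close>
      using AE_lborel_singleton[of "c + a"] AE_lborel_singleton[of "d + a"]
    proof eventually_elim
      case (elim t)
      have lim: "(\<lambda>n. t - X n) \<longlonglongrightarrow> t - a"
        using X by (intro tendsto_intros)
      have "(\<lambda>n. indicator {c..d} (t - X n) :: complex) \<longlonglongrightarrow> indicator {c..d} (t - a)"
      proof (rule tendsto_eventually)
        consider "t - a < c" | "t - a > d" | "c < t - a" "t - a < d"
          using elim by fastforce
        then show "\<forall>\<^sub>F n in sequentially. indicator {c..d} (t - X n) = (indicator {c..d} (t - a) :: complex)"
        proof cases
          case 1
          show ?thesis
            using order_tendstoD(2)[OF lim 1] by eventually_elim (use 1 in \<open>simp add: indicator_def\<close>)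
        next
          case 2
          show ?thesis
            using order_tendstoD(1)[OF lim 2] by eventually_elim (use 2 in \<open>simp add: indicator_def\<close>)
        next
          case 3
          show ?thesis
            using order_tendstoD(1)[OF lim 3(1)] order_tendstoD(2)[OF lim 3(2)]
            by eventually_elim (use 3 in \<open>simp add: indicator_def\<close>)
        qed
      qed
      then show ?case
        unfolding tf_shift_def using Y by (intro tendsto_intros)
    qed
    show "(cmod (tf_shift (indicator {c..d}) (X n) (Y n) t - tf_shift (indicator {c..d}) a b t))\<^sup>2
        \<le> 4 * indicator {c - B..d + B} t" for n t
    proof -
      have "cmod (tf_shift (indicator {c..d}) (X n) (Y n) t - tf_shift (indicator {c..d}) a b t)
          \<le> 2 * indicator {c - B..d + B} t"
        using norm_triangle_ineq4 bound[OF XB[of n], of "Y n" t] bound[OF aB, of b t]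
        by (smt (verit))
      then have "(cmod (tf_shift (indicator {c..d}) (X n) (Y n) t - tf_shift (indicator {c..d}) a b t))\<^sup>2
          \<le> (2 * indicator {c - B..d + B} t)\<^sup>2"
        by (rule power_mono) simp
      also have "\<dots> = 4 * indicator {c - B..d + B} t"
        by (simp add: indicator_def)
      finally show ?thesis .
    qed
  qed (use in_L2_borel[OF in_L2_tf_shift[OF in_L2_indicator_interval]]
      in \<open>simp_all add: emeasure_lborel_Icc_eq\<close>)
qed

text \<open>Shifts are isometries, so replacing f by a nearby function costs the same at every
  parameter. This lets strong continuity pass to L^2 limits by an \<epsilon>/3 argument.\<close>

lemma tf_shift_tendsto:
  fixes X Y :: "nat \<Rightarrow> real"
  assumes "in_L2 f" and X: "X \<longlonglongrightarrow> a" and Y: "Y \<longlonglongrightarrow> b"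
  shows "(\<lambda>n. L2_norm (\<lambda>t. tf_shift f (X n) (Y n) t - tf_shift f a b t)) \<longlonglongrightarrow> 0"
  using assms(1)
proof (induction rule: L2_induct)
  case (interval c d)
  show ?case using X Y by (rule tf_shift_interval_tendsto)
next
  case (add f g)
  show ?case
  proof (rule Lim_null_comparison[OF _ tendsto_add_zero[OF add.IH]])
    have "L2_norm (\<lambda>t. tf_shift (\<lambda>t. f t + g t) x y t - tf_shift (\<lambda>t. f t + g t) a b t)
        \<le> L2_norm (\<lambda>t. tf_shift f x y t - tf_shift f a b t) + L2_norm (\<lambda>t. tf_shift g x y t - tf_shift g a b t)" for x y
      unfolding tf_shift_add add_diff_add
      by (intro L2_norm_triangle in_L2_diff in_L2_tf_shift add.hyps)
    then show "\<forall>\<^sub>F n in sequentially.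
        norm (L2_norm (\<lambda>t. tf_shift (\<lambda>t. f t + g t) (X n) (Y n) t - tf_shift (\<lambda>t. f t + g t) a b t))
        \<le> L2_norm (\<lambda>t. tf_shift f (X n) (Y n) t - tf_shift f a b t) + L2_norm (\<lambda>t. tf_shift g (X n) (Y n) t - tf_shift g a b t)"
      by (simp add: L2_norm_nonneg)
  qed
next
  case (scale c f)
  have "L2_norm (\<lambda>t. tf_shift (\<lambda>t. c * f t) x y t - tf_shift (\<lambda>t. c * f t) a b t) =
      cmod c * L2_norm (\<lambda>t. tf_shift f x y t - tf_shift f a b t)" for x y
    unfolding L2_norm_scale[symmetric] by (simp add: tf_shift_def algebra_simps)
  then show ?case
    using tendsto_mult_right_zero[OF scale.IH, of "cmod c"] by simp
next
  case (lim f s)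
  show ?case
  proof (rule LIMSEQ_I)
    fix \<epsilon> :: real assume "\<epsilon> > 0"
    then have "\<forall>\<^sub>F m in sequentially. L2_norm (\<lambda>t. s m t - f t) < \<epsilon> / 3"
      by (intro order_tendstoD(2)[OF lim(3)]) simp
    then obtain m where m: "L2_norm (\<lambda>t. s m t - f t) < \<epsilon> / 3"
      by (meson eventually_happens' sequentially_bot)
    have "\<forall>\<^sub>F n in sequentially. L2_norm (\<lambda>t. tf_shift (s m) (X n) (Y n) t - tf_shift (s m) a b t) < \<epsilon> / 3"
      using \<open>\<epsilon> > 0\<close> by (intro order_tendstoD(2)[OF lim(4)]) simp
    then obtain n0 where n0: "\<And>n. n \<ge> n0 \<Longrightarrow>
        L2_norm (\<lambda>t. tf_shift (s m) (X n) (Y n) t - tf_shift (s m) a b t) < \<epsilon> / 3"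
      by (auto simp: eventually_sequentially)
    have "L2_norm (\<lambda>t. tf_shift f (X n) (Y n) t - tf_shift f a b t) < \<epsilon>" if "n \<ge> n0" for n
    proof -
      have "L2_norm (\<lambda>t. tf_shift f (X n) (Y n) t - tf_shift f a b t) \<le>
          L2_norm (\<lambda>t. tf_shift f (X n) (Y n) t - tf_shift (s m) (X n) (Y n) t) +
          L2_norm (\<lambda>t. tf_shift (s m) (X n) (Y n) t - tf_shift f a b t)"
        by (intro L2_norm_diff_triangle in_L2_tf_shift lim)
      moreover have "L2_norm (\<lambda>t. tf_shift (s m) (X n) (Y n) t - tf_shift f a b t) \<le>
          L2_norm (\<lambda>t. tf_shift (s m) (X n) (Y n) t - tf_shift (s m) a b t) +
          L2_norm (\<lambda>t. tf_shift (s m) a b t - tf_shift f a b t)"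
        by (intro L2_norm_diff_triangle in_L2_tf_shift lim)
      ultimately show ?thesis
        using m n0[OF that] by (simp add: L2_norm_tf_shift_diff L2_norm_minus_commute[of f])
    qed
    then show "\<exists>n0. \<forall>n\<ge>n0. norm (L2_norm (\<lambda>t. tf_shift f (X n) (Y n) t - tf_shift f a b t) - 0) < \<epsilon>"
      by (auto simp: L2_norm_nonneg)
  qed
qed

section \<open>Approximation with a margin common to all shifts\<close>

lemma gabor_sum_extend:
  assumes "F \<subseteq> G" "finite G"
  shows "\<exists>d. \<forall>t. (\<Sum>k\<in>F. c k * gabor_box k t) = (\<Sum>k\<in>G. d k * gabor_box k t)"
proof (intro exI allI)
  fix t
  show "(\<Sum>k\<in>F. c k * gabor_box k t) = (\<Sum>k\<in>G. (if k \<in> F then c k else 0) * gabor_box k t)"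
    using assms by (intro sum.mono_neutral_cong_left) auto
qed

text \<open>If no margin worked, each S would have a bad parameter \<open>z S\<close>. At a limit
  point of these, finitely many boxes approximate the shift well; strong continuity carries that
  approximation to nearby bad parameters with large margin, a contradiction.\<close>

lemma tf_shift_approx_unit_square:
  assumes g: "in_L2 g" and "\<epsilon> > 0"
  shows "\<exists>S::nat. \<forall>a\<in>{0..1}. \<forall>b\<in>{0..1}. \<exists>c.
    L2_norm (\<lambda>t. tf_shift g a b t - (\<Sum>k\<in>{-int S..int S} \<times> {-int S..int S}. c k * gabor_box k t)) < \<epsilon>"
proof (rule ccontr)
  let ?B = "\<lambda>S::nat. {-int S..int S} \<times> {-int S..int S}"
  assume neg: "\<not> ?thesis"
  have ex: "\<forall>S. \<exists>z. z \<in> {0..1} \<times> {0..1} \<and> (\<forall>c.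
      \<not> L2_norm (\<lambda>t. tf_shift g (fst z) (snd z) t - (\<Sum>k\<in>?B S. c k * gabor_box k t)) < \<epsilon>)"
  proof
    fix S
    obtain a b where "a \<in> {0..1}" "b \<in> {0..1}" and
        "\<not> (\<exists>c. L2_norm (\<lambda>t. tf_shift g a b t - (\<Sum>k\<in>?B S. c k * gabor_box k t)) < \<epsilon>)"
      using neg by blast
    then show "\<exists>z. z \<in> {0..1} \<times> {0..1} \<and> (\<forall>c.
        \<not> L2_norm (\<lambda>t. tf_shift g (fst z) (snd z) t - (\<Sum>k\<in>?B S. c k * gabor_box k t)) < \<epsilon>)"
      by (intro exI[of _ "(a, b)"]) (simp del: not_less)
  qed
  from choice[OF ex] obtain z where z: "\<And>S. z S \<in> {0..1} \<times> {0..1}" and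
      bad: "\<And>S c. \<not> L2_norm (\<lambda>t. tf_shift g (fst (z S)) (snd (z S)) t - (\<Sum>k\<in>?B S. c k * gabor_box k t)) < \<epsilon>"
    by blast
  have "compact ({0..1::real} \<times> {0..1::real})"
    by (intro compact_Times compact_Icc)
  then obtain l r where r: "strict_mono r" "(z \<circ> r) \<longlonglongrightarrow> l"
    using compact_imp_seq_compact seq_compactE z by metis
  obtain F c where F: "finite F"
      "L2_norm (\<lambda>t. tf_shift g (fst l) (snd l) t - (\<Sum>k\<in>F. c k * gabor_box k t)) < \<epsilon> / 2"
    using gabor_limit_L2[OF in_L2_tf_shift[OF g]] \<open>\<epsilon> > 0\<close> unfolding gabor_limit_def by (meson half_gt_zero)
  \<comment> \<open>A sum of nonnegative terms serves as a common bound, also for empty F.\<close>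
  obtain S0 where S0: "\<And>k. k \<in> F \<Longrightarrow> nat \<bar>fst k\<bar> \<le> S0 \<and> nat \<bar>snd k\<bar> \<le> S0"
  proof
    fix k assume "k \<in> F"
    then have "max (nat \<bar>fst k\<bar>) (nat \<bar>snd k\<bar>) \<le> (\<Sum>k\<in>F. max (nat \<bar>fst k\<bar>) (nat \<bar>snd k\<bar>))"
      using F(1) by (intro member_le_sum) auto
    then show "nat \<bar>fst k\<bar> \<le> (\<Sum>k\<in>F. max (nat \<bar>fst k\<bar>) (nat \<bar>snd k\<bar>)) \<and>
        nat \<bar>snd k\<bar> \<le> (\<Sum>k\<in>F. max (nat \<bar>fst k\<bar>) (nat \<bar>snd k\<bar>))"
      by simp
  qed
  have "(\<lambda>n. L2_norm (\<lambda>t. tf_shift g (fst ((z \<circ> r) n)) (snd ((z \<circ> r) n)) t - tf_shift g (fst l) (snd l) t)) \<longlonglongrightarrow> 0"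
    by (rule tf_shift_tendsto[OF g tendsto_fst[OF r(2)] tendsto_snd[OF r(2)]])
  then have "\<forall>\<^sub>F n in sequentially.
      L2_norm (\<lambda>t. tf_shift g (fst ((z \<circ> r) n)) (snd ((z \<circ> r) n)) t - tf_shift g (fst l) (snd l) t) < \<epsilon> / 2"
    using \<open>\<epsilon> > 0\<close> by (intro order_tendstoD(2)) auto
  then have "\<forall>\<^sub>F n in sequentially. n \<ge> S0 \<and>
      L2_norm (\<lambda>t. tf_shift g (fst ((z \<circ> r) n)) (snd ((z \<circ> r) n)) t - tf_shift g (fst l) (snd l) t) < \<epsilon> / 2"
    using eventually_ge_at_top eventually_conj by blast
  then obtain n where n: "n \<ge> S0"
      "L2_norm (\<lambda>t. tf_shift g (fst (z (r n))) (snd (z (r n))) t - tf_shift g (fst l) (snd l) t) < \<epsilon> / 2"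
    using eventually_happens'[OF sequentially_bot] by (auto simp: comp_def)
  \<comment> \<open>A strictly increasing r satisfies n <= r n, so the margin at the chosen bad
    parameter already contains F.\<close>
  have "S0 \<le> r n"
    using seq_suble[OF r(1), of n] n(1) by linarith
  then have "F \<subseteq> ?B (r n)"
    using S0 by fastforce
  then obtain d where d: "\<And>t. (\<Sum>k\<in>F. c k * gabor_box k t) = (\<Sum>k\<in>?B (r n). d k * gabor_box k t)"
    using gabor_sum_extend[of F "?B (r n)" c] by auto
  have "L2_norm (\<lambda>t. tf_shift g (fst (z (r n))) (snd (z (r n))) t - (\<Sum>k\<in>F. c k * gabor_box k t)) \<le>
      L2_norm (\<lambda>t. tf_shift g (fst (z (r n))) (snd (z (r n))) t - tf_shift g (fst l) (snd l) t) +
      L2_norm (\<lambda>t. tf_shift g (fst l) (snd l) t - (\<Sum>k\<in>F. c k * gabor_box k t))"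
    by (intro L2_norm_diff_triangle in_L2_tf_shift g in_L2_gabor_sum)
  then show False
    using bad[of "r n" d] n(2) F(2) unfolding d by linarith
qed

text \<open>Commuting a translation past a modulation costs a phase, which is trivial for integers;
  lattice shifts therefore permute the boxes exactly.\<close>

lemma tf_shift_gabor_box:
  fixes m l :: int
  shows "tf_shift (gabor_box (i, j)) m l = gabor_box (m + i, l + j)"
proof
  fix t :: real
  have "cis (2 * pi * l * t) * cis (2 * pi * j * (t - m)) =
      cis (2 * pi * (l + j) * t) * cis (2 * pi * of_int (- j * m))"
    by (simp add: cis_mult algebra_simps)
  also have "cis (2 * pi * of_int (- j * m)) = 1"
    by (rule cis_multiple_2pi) (rule Ints_of_int)
  finally have "cis (2 * pi * l * t) * cis (2 * pi * j * (t - m)) = cis (2 * pi * (l + j) * t)"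
    by simp
  then show "tf_shift (gabor_box (i, j)) m l t = gabor_box (m + i, l + j) t"
    by (simp add: tf_shift_def gabor_box_eq mult.assoc[symmetric]) (simp add: indicator_def algebra_simps)
qed

text \<open>Up to a unimodular factor, a shift is a lattice shift applied to the shift by the
  fractional parts. The lattice shift is an isometry permuting the boxes, so the margin and the
  error found on the unit square remain valid everywhere.\<close>

lemma tf_shift_approx:
  assumes g: "in_L2 g" and "\<epsilon> > 0"
  shows "\<exists>S::nat. \<forall>a b. \<exists>c. L2_norm (\<lambda>t. tf_shift g a b t -
    (\<Sum>k\<in>{\<lfloor>a\<rfloor> - int S..\<lfloor>a\<rfloor> + int S} \<times> {\<lfloor>b\<rfloor> - int S..\<lfloor>b\<rfloor> + int S}. c k * gabor_box k t)) < \<epsilon>"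
proof -
  obtain S :: nat where S: "\<And>a b. a \<in> {0..1} \<Longrightarrow> b \<in> {0..1} \<Longrightarrow> \<exists>c.
    L2_norm (\<lambda>t. tf_shift g a b t - (\<Sum>k\<in>{-int S..int S} \<times> {-int S..int S}. c k * gabor_box k t)) < \<epsilon>"
    using tf_shift_approx_unit_square[OF assms] by blast
  show ?thesis
  proof (intro exI[of _ S] allI)
    fix a b :: real
    define m l where "m = \<lfloor>a\<rfloor>" and "l = \<lfloor>b\<rfloor>"
    have "a - m \<in> {0..1}" "b - l \<in> {0..1}"
      by (auto simp: m_def l_def) linarith+
    then obtain c where c: "L2_norm (\<lambda>t. tf_shift g (a - m) (b - l) t -
        (\<Sum>k\<in>{-int S..int S} \<times> {-int S..int S}. c k * gabor_box k t)) < \<epsilon>" (is "L2_norm ?r < _")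
      using S by blast
    \<comment> \<open>The phase produced when the fractional modulation is evaluated at t - m
      instead of t.\<close>
    define u where "u = cis (2 * pi * (b - l) * m)"
    have shift: "tf_shift g a b t = u * tf_shift (tf_shift g (a - m) (b - l)) m l t" for t
    proof -
      have "2 * pi * b * t = 2 * pi * (b - l) * m + (2 * pi * l * t + 2 * pi * (b - l) * (t - m))"
        by (simp add: algebra_simps)
      then have "cis (2 * pi * b * t) = u * (cis (2 * pi * l * t) * cis (2 * pi * (b - l) * (t - m)))"
        by (simp only: u_def cis_mult)
      then show ?thesis by (simp add: tf_shift_def mult.assoc)
    qed
    define d where "d k = u * c (fst k - m, snd k - l)" for k
    have sum: "(\<Sum>k\<in>{m - int S..m + int S} \<times> {l - int S..l + int S}. d k * gabor_box k t) =
        u * tf_shift (\<lambda>t. \<Sum>k\<in>{-int S..int S} \<times> {-int S..int S}. c k * gabor_box k t) m l t" for t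
    proof -
      have "(\<Sum>k\<in>{m - int S..m + int S} \<times> {l - int S..l + int S}. d k * gabor_box k t) =
          (\<Sum>k\<in>{-int S..int S} \<times> {-int S..int S}. u * c k * tf_shift (gabor_box k) m l t)"
        by (rule sum.reindex_bij_witness[where j = "\<lambda>k. (fst k - m, snd k - l)" and i = "\<lambda>k. (m + fst k, l + snd k)"])
          (auto simp: d_def tf_shift_gabor_box)
      then show ?thesis
        by (simp add: tf_shift_def sum_distrib_left mult_ac)
    qed
    have "L2_norm (\<lambda>t. tf_shift g a b t -
        (\<Sum>k\<in>{m - int S..m + int S} \<times> {l - int S..l + int S}. d k * gabor_box k t)) = L2_norm ?r"
      unfolding sum shift right_diff_distrib[symmetric] L2_norm_scale L2_norm_tf_shift_diff
      by (simp add: u_def)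
    then show "\<exists>c. L2_norm (\<lambda>t. tf_shift g a b t -
        (\<Sum>k\<in>{\<lfloor>a\<rfloor> - int S..\<lfloor>a\<rfloor> + int S} \<times> {\<lfloor>b\<rfloor> - int S..\<lfloor>b\<rfloor> + int S}. c k * gabor_box k t)) < \<epsilon>"
      using c unfolding m_def l_def by (intro exI[of _ d]) simp
  qed
qed

subsection \<open>The density bound\<close>

text \<open>The disjoint union \<open>Sigma I A\<close> keeps points belonging to several sets
  apart, as the sum of the cardinalities requires. Bounding finite subsets suffices: an infinite set
  would contain finite ones of any size.\<close>

lemma sum_ecard_le:
  fixes A :: "nat \<Rightarrow> 'a set"
  assumes "finite I"
    and card: "\<And>J. finite J \<Longrightarrow> J \<subseteq> Sigma I A \<Longrightarrow> real (card J) \<le> B"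
  shows "(\<Sum>n\<in>I. ecard (A n)) \<le> ereal B"
proof -
  have fin: "finite (A n)" if "n \<in> I" for n
  proof (rule ccontr)
    assume "infinite (A n)"
    then obtain T where T: "T \<subseteq> A n" "finite T" "card T = nat \<lceil>B\<rceil> + 1"
      by (meson infinite_arbitrarily_large)
    have "real (card (Pair n ` T)) \<le> B"
      using T \<open>n \<in> I\<close> by (intro card) auto
    moreover have "card (Pair n ` T) = nat \<lceil>B\<rceil> + 1"
      using T by (simp add: card_image inj_on_def)
    ultimately show False by linarith
  qed
  have "(\<Sum>n\<in>I. ecard (A n)) = (\<Sum>n\<in>I. ereal (real (card (A n))))"
    using fin by (intro sum.cong) (auto simp: ecard_def)
  also have "\<dots> = ereal (real (card (Sigma I A)))"
    using assms(1) fin by (simp add: card_SigmaI)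
  also have "\<dots> \<le> ereal B"
    using card[OF finite_SigmaI subset_refl] assms(1) fin by (simp del: card_SigmaI)
  finally show ?thesis .
qed

lemma card_int_interval_le:
  assumes "x \<le> y"
  shows "real (card {\<lfloor>x\<rfloor> - int S..\<lfloor>y\<rfloor> + int S}) \<le> y - x + 2 * real S + 2"
proof -
  have "\<lfloor>x\<rfloor> \<le> \<lfloor>y\<rfloor>" using assms by (rule floor_mono)
  then have "real (card {\<lfloor>x\<rfloor> - int S..\<lfloor>y\<rfloor> + int S}) = real_of_int (\<lfloor>y\<rfloor> - \<lfloor>x\<rfloor>) + 2 * real S + 1"
    by simp
  \<comment> \<open>The difference of the floors is less than y - x + 1, and counting both endpoints
    adds another 1.\<close>
  then show ?thesis by linarith
qed

lemma uniformly_minimal_dist: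
  assumes "L2_dist_span e (I - {i}) (e i) > \<delta>" "finite F" "F \<subseteq> I - {i}"
  shows "\<delta> \<le> L2_norm (\<lambda>t. e i t - (\<Sum>j\<in>F. c j * e j t))"
proof -
  have "L2_dist_span e (I - {i}) (e i) \<le> L2_norm (\<lambda>t. e i t - (\<Sum>j\<in>F. c j * e j t))"
    unfolding L2_dist_span_def
  proof (rule cInf_lower)
    show "bdd_below {L2_norm (\<lambda>t. e i t - (\<Sum>i\<in>F. c i * e i t)) |F c. finite F \<and> F \<subseteq> I - {i}}"
      by (rule bdd_belowI[of _ 0]) (auto simp: L2_norm_nonneg)
  qed (use assms in blast)
  then show ?thesis using assms(1) by simp
qed

text \<open>The order of quantifiers matters: S is fixed by \<theta> before the square and the
  finite subfamily are chosen.\<close>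

lemma uniformly_minimal_card_le:
  fixes N :: nat and g :: "nat \<Rightarrow> real \<Rightarrow> complex" and \<Lambda> :: "nat \<Rightarrow> (real \<times> real) set"
  defines "e \<equiv> \<lambda>(n, (a, b)). tf_shift (g n) a b"
  assumes g: "\<And>n. n \<in> {1..N} \<Longrightarrow> in_L2 (g n)"
    and min: "uniformly_minimal e {(n, p). n \<in> {1..N} \<and> p \<in> \<Lambda> n}"
    and "\<theta> > 0"
  shows "\<exists>S::nat. \<forall>a b R J. R \<ge> 0 \<longrightarrow> finite J \<longrightarrow> J \<subseteq> (SIGMA n:{1..N}. \<Lambda> n \<inter> Qsq a b R) \<longrightarrow>
    real (card J) * (1 - \<theta>) \<le> (2 * R + 2 * real S + 2)\<^sup>2"
proof -
  let ?I = "{(n, p). n \<in> {1..N} \<and> p \<in> \<Lambda> n}"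
  obtain \<delta> where \<delta>: "\<delta> > 0" "\<And>i. i \<in> ?I \<Longrightarrow> L2_dist_span e (?I - {i}) (e i) > \<delta>"
    using min unfolding uniformly_minimal_def by blast
  \<comment> \<open>Makes the relative loss \<epsilon> / \<delta> in the trace comparison equal to
    \<theta>.\<close>
  define \<epsilon> where "\<epsilon> = \<theta> * \<delta>"
  have "\<epsilon> > 0" using \<open>\<theta> > 0\<close> \<delta>(1) by (simp add: \<epsilon>_def)
  let ?K = "\<lambda>S a b. {\<lfloor>a\<rfloor> - int S..\<lfloor>a\<rfloor> + int S} \<times> {\<lfloor>b\<rfloor> - int S..\<lfloor>b\<rfloor> + int S}"
  have "\<exists>S. \<forall>n\<in>{1..N}. \<forall>a b. \<exists>c. L2_norm (\<lambda>t. tf_shift (g n) a b t - (\<Sum>k\<in>?K (S n) a b. c k * gabor_box k t)) < \<epsilon>"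
    using tf_shift_approx[OF g \<open>\<epsilon> > 0\<close>] by (intro bchoice) blast
  then obtain S where S: "\<And>n a b. n \<in> {1..N} \<Longrightarrow>
      \<exists>c. L2_norm (\<lambda>t. tf_shift (g n) a b t - (\<Sum>k\<in>?K (S n) a b. c k * gabor_box k t)) < \<epsilon>"
    by blast
  \<comment> \<open>One margin for all windows; the sum dominates every \<open>S n\<close>, also
    when N = 0.\<close>
  define T where "T = (\<Sum>n\<in>{1..N}. S n)"
  have ST: "S n \<le> T" if "n \<in> {1..N}" for n
    unfolding T_def using that by (intro member_le_sum) auto
  show ?thesis
  proof (intro exI[of _ T] allI impI)
    fix a0 b0 R :: real and J
    assume R: "R \<ge> 0" and J: "finite J" "J \<subseteq> (SIGMA n:{1..N}. \<Lambda> n \<inter> Qsq a0 b0 R)"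
    \<comment> \<open>Contains the lattice square of margin T around the floor of every point of the
      square.\<close>
    define K where "K = {\<lfloor>a0 - R\<rfloor> - int T..\<lfloor>a0 + R\<rfloor> + int T} \<times> {\<lfloor>b0 - R\<rfloor> - int T..\<lfloor>b0 + R\<rfloor> + int T}"
    have JI: "J \<subseteq> ?I" using J(2) by auto
    have "real (card J) * (1 - \<epsilon> / \<delta>) \<le> real (card K)"
    proof (rule card_le_of_approximate_containment[where e = e and \<phi> = gabor_box])
      show "in_L2 (e j)" if "j \<in> J" for j
        using that JI g by (force simp: e_def intro: in_L2_tf_shift)
      show "\<delta> \<le> L2_norm (\<lambda>t. e j t - (\<Sum>i\<in>J - {j}. c i * e i t))" if "j \<in> J" for j c
        using that JI J(1) \<delta>(2) by (intro uniformly_minimal_dist[where I = ?I]) auto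
      show "\<exists>c. L2_norm (\<lambda>t. e j t - (\<Sum>k\<in>K. c k * gabor_box k t)) \<le> \<epsilon>" if jJ: "j \<in> J" for j
      proof -
        obtain n a b where j: "j = (n, (a, b))" by (metis surj_pair)
        then have n: "n \<in> {1..N}" and ab: "\<bar>a - a0\<bar> \<le> R" "\<bar>b - b0\<bar> \<le> R"
          using jJ J(2) by (auto simp: Qsq_def)
        obtain c where c: "L2_norm (\<lambda>t. tf_shift (g n) a b t - (\<Sum>k\<in>?K (S n) a b. c k * gabor_box k t)) < \<epsilon>"
          using S[OF n] by blast
        have "\<lfloor>a0 - R\<rfloor> \<le> \<lfloor>a\<rfloor>" "\<lfloor>a\<rfloor> \<le> \<lfloor>a0 + R\<rfloor>" "\<lfloor>b0 - R\<rfloor> \<le> \<lfloor>b\<rfloor>" "\<lfloor>b\<rfloor> \<le> \<lfloor>b0 + R\<rfloor>"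
          using ab by (auto intro!: floor_mono)
        then have "?K (S n) a b \<subseteq> K"
          using ST[OF n] unfolding K_def by (intro Sigma_mono) auto
        then obtain d where "\<And>t. (\<Sum>k\<in>?K (S n) a b. c k * gabor_box k t) = (\<Sum>k\<in>K. d k * gabor_box k t)"
          using gabor_sum_extend[of "?K (S n) a b" K c] by (auto simp: K_def)
        then show ?thesis
          using c by (intro exI[of _ d]) (simp add: j e_def)
      qed
    qed (use J \<delta> in \<open>auto simp: K_def in_L2_gabor_box gabor_box_orthonormal\<close>)
    also have "\<epsilon> / \<delta> = \<theta>" using \<delta>(1) by (simp add: \<epsilon>_def)
    also have "real (card K) \<le> (2 * R + 2 * real T + 2) * (2 * R + 2 * real T + 2)"
      using card_int_interval_le[of "a0 - R" "a0 + R" T] card_int_interval_le[of "b0 - R" "b0 + R" T] R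
      unfolding K_def card_cartesian_product of_nat_mult by (intro mult_mono) auto
    finally show "real (card J) * (1 - \<theta>) \<le> (2 * R + 2 * real T + 2)\<^sup>2"
      by (simp add: power2_eq_square)
  qed
qed

lemma upper_density_le:
  assumes B: "\<And>a b R. R > 0 \<Longrightarrow> (\<Sum>n\<in>{1..N}. ecard (\<Lambda> n \<inter> Qsq a b R)) \<le> ereal (B R)"
    and lim: "((\<lambda>R. B R / (2 * R)\<^sup>2) \<longlongrightarrow> L) at_top"
  shows "upper_density N \<Lambda> \<le> ereal L"
proof -
  have "upper_density N \<Lambda> \<le> Limsup at_top (\<lambda>R. ereal (B R / (2 * R)\<^sup>2))"
    unfolding upper_density_def
  proof (rule Limsup_mono)
    show "\<forall>\<^sub>F R in at_top. (SUP ab. \<Sum>n\<in>{1..N}. ecard (\<Lambda> n \<inter> Qsq (fst ab) (snd ab) R)) / ereal ((2 * R)\<^sup>2)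
        \<le> ereal (B R / (2 * R)\<^sup>2)"
      using eventually_gt_at_top[of 0]
    proof eventually_elim
      case (elim R)
      have "(SUP ab. \<Sum>n\<in>{1..N}. ecard (\<Lambda> n \<inter> Qsq (fst ab) (snd ab) R)) \<le> ereal (B R)"
        using B[OF elim] by (intro SUP_least)
      then have "(SUP ab. \<Sum>n\<in>{1..N}. ecard (\<Lambda> n \<inter> Qsq (fst ab) (snd ab) R)) / ereal ((2 * R)\<^sup>2)
          \<le> ereal (B R) / ereal ((2 * R)\<^sup>2)"
        using elim by (intro ereal_divide_right_mono) auto
      then show ?case using elim by simp
    qed
  qed
  also have "\<dots> = ereal L"
    by (rule lim_imp_Limsup) (use lim in auto)
  finally show ?thesis .
qed

theorem theorem2:
  fixes N :: nat and g :: "nat \<Rightarrow> real \<Rightarrow> complex" and \<Lambda> :: "nat \<Rightarrow> (real \<times> real) set"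
  assumes "\<And>n. n \<in> {1..N} \<Longrightarrow> in_L2 (g n)"
    and "uniformly_minimal (\<lambda>(n, (a, b)). tf_shift (g n) a b)
           {(n, p). n \<in> {1..N} \<and> p \<in> \<Lambda> n}"
  shows "upper_density N \<Lambda> \<le> 1"
proof (rule ereal_le_epsilon2)
  show "upper_density N \<Lambda> \<le> 1 + ereal \<eta>" if "\<eta> > 0" for \<eta> :: real
  proof -
    \<comment> \<open>Chosen so that dividing by 1 - \<theta> costs exactly the factor 1 +
      \<eta>.\<close>
    define \<theta> where "\<theta> = \<eta> / (1 + \<eta>)"
    have \<theta>: "\<theta> > 0" "1 - \<theta> > 0" "1 / (1 - \<theta>) = 1 + \<eta>"
      using \<open>\<eta> > 0\<close> by (auto simp: \<theta>_def field_simps)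
    obtain S :: nat where S: "\<And>a b R J. R \<ge> 0 \<Longrightarrow> finite J \<Longrightarrow>
        J \<subseteq> (SIGMA n:{1..N}. \<Lambda> n \<inter> Qsq a b R) \<Longrightarrow>
        real (card J) * (1 - \<theta>) \<le> (2 * R + 2 * real S + 2)\<^sup>2"
      using uniformly_minimal_card_le[OF assms \<theta>(1)] by blast
    have "upper_density N \<Lambda> \<le> ereal (1 + \<eta>)"
    proof (rule upper_density_le[where B = "\<lambda>R. (2 * R + 2 * real S + 2)\<^sup>2 / (1 - \<theta>)"])
      show "(\<Sum>n\<in>{1..N}. ecard (\<Lambda> n \<inter> Qsq a b R)) \<le> ereal ((2 * R + 2 * real S + 2)\<^sup>2 / (1 - \<theta>))"
        if "R > 0" for a b R
      proof (rule sum_ecard_le)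
        fix J assume "finite J" "J \<subseteq> (SIGMA n:{1..N}. \<Lambda> n \<inter> Qsq a b R)"
        then show "real (card J) \<le> (2 * R + 2 * real S + 2)\<^sup>2 / (1 - \<theta>)"
          using S[of R J a b] that \<theta>(2) by (simp add: pos_le_divide_eq)
      qed simp
      have "((\<lambda>R. (2 * R + 2 * real S + 2) / (2 * R)) \<longlongrightarrow> 1) at_top"
      proof (rule Lim_transform_eventually)
        have "((\<lambda>R. 1 + (real S + 1) * inverse R) \<longlongrightarrow> 1 + (real S + 1) * 0) at_top"
          by (intro tendsto_intros tendsto_inverse_0_at_top filterlim_ident)
        then show "((\<lambda>R. 1 + (real S + 1) * inverse R) \<longlongrightarrow> 1) at_top"
          by simp
        show "\<forall>\<^sub>F R in at_top. 1 + (real S + 1) * inverse R = (2 * R + 2 * real S + 2) / (2 * R)"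
          using eventually_gt_at_top[of 0] by eventually_elim (simp add: field_simps)
      qed
      then have "((\<lambda>R. ((2 * R + 2 * real S + 2) / (2 * R))\<^sup>2 * (1 / (1 - \<theta>))) \<longlongrightarrow> 1\<^sup>2 * (1 / (1 - \<theta>))) at_top"
        by (intro tendsto_intros)
      then show "((\<lambda>R. (2 * R + 2 * real S + 2)\<^sup>2 / (1 - \<theta>) / (2 * R)\<^sup>2) \<longlongrightarrow> 1 + \<eta>) at_top"
        unfolding \<theta>(3)[symmetric] by (simp add: power_divide mult.commute)
    qed
    then show ?thesis
      by (simp add: one_ereal_def)
  qed
qed

end
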